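(* Suppose that the convergence assumption, the source condition and the non-empty interior assumption (all stated in the context) hold. Let $u_n$ be a minimiser of $$\min_{u\in L^1,\ u\geq0}\mathcal J(u)\quad\text{s.t. }B_nu\leq\phi_n ,$$ let $(\lambda_n,\mu_n)$ be a solution of the corresponding dual problem, $p_n=\lambda_n-B_n^*\mu_n$, and let $\hat p$ be the limit subgradient (see the context). Then there is a constant $C$, independent of $n$, such that for any $\mathcal J$-minimising solution $\bar u_{\mathcal J}$ the symmetric Bregman distance $D^{symm}_{\mathcal J}(\bar u_{\mathcal J},u_n)=(p_n-\hat p,\,u_n-\bar u_{\mathcal J})$ satisfies $$D^{symm}_{\mathcal J}(\bar u_{\mathcal J},u_n)\leq C\,\|\bar\mu\|_1\,\varepsilon_n .$$
   Context: $\Omega\subset\mathbb R^m$ is a bounded domain, $L^1=L^1(\Omega)$, $L^\infty=L^\infty(\Omega)$, $\mathbf 1$ is the constant function one, and $(\cdot,\cdot)$ denotes duality pairings. Functions are ordered a.e. pointwise; for regular linear operators $L^1\to L^\infty$ (differences of two positive operators), $S\geq T$ means that $(S-T)u\geq0$ for all $u\geq 0$; $\mu\in(L^\infty)^*$ satisfies $\mu\geq0$ iff $(\mu,\psi)\geq0$ for all $0\leq\psi\in L^\infty$; pairs are ordered componentwise and an inequality between a pair and a scalar function is meant componentwise. $\|\mu\|_1$ denotes the norm of $\mu$ in $(L^\infty)^*\times(L^\infty)^*$, so $\|\mu\|_1=(\mu,\mathbf 1)$ for $\mu\geq0$. $A\colon L^1\to L^\infty$ is a linear operator and $f\in L^\infty$.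 Sequences of bounds satisfy $f^l_n\leq f\leq f^u_n$, $f^l_{n+1}\geq f^l_n$, $f^u_{n+1}\leq f^u_n$, $A^l_n\leq A\leq A^u_n$, $A^l_{n+1}\geq A^l_n$, $A^u_{n+1}\leq A^u_n$, $\|f^u_n-f^l_n\|_\infty\to0$, $\|A^u_n-A^l_n\|\to0$. Put $B_nu=(A^l_nu,-A^u_nu)$, $\phi_n=(f^u_n,-f^l_n)$, $\bar Bu=(Au,-Au)$, $\bar\phi=(f,-f)$. The dual problem is $\max_{\lambda\geq0,\mu\geq0}(\mu,-\phi_n)$ s.t. $\lambda-B_n^*\mu\in\partial\mathcal J(0)$, with $\lambda\in L^\infty$, $\mu\in(L^\infty)^*\times(L^\infty)^*$; $B_n^*,\bar B^*\colon(L^\infty)^*\times(L^\infty)^*\to L^\infty$ are the adjoints. $\mathcal J\colon L^1\to[0,\infty]$ is convex, proper and absolutely one-homogeneous. $\partial\mathcal J(u)=\{p\in L^\infty:\ \mathcal J(v)\geq(p,v)\ \forall v\in L^1,\ \mathcal J(u)=(p,u)\}$, so $\partial\mathcal J(0)=\{p\in L^\infty:\mathcal J(v)\geq(p,v)\ \forall v\in L^1\}$. Standing assumption: $Au=f$ has a non-negative solution with finite $\mathcal J$, and $\bar u_{\mathcal J}$ denotes a (possibly non-unique) $\mathcal J$-minimising solution, i.e. a minimiser of $\mathcal J(u)$ over $u\in L^1$, $u\geq0$, $Au=f$. Limit subgradient: let $\mathcal V=\{u\in L^1:\mathcal J(u)<\infty\}$, normed by $\mathcal J$, with dual $\mathcal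 V^*$. All statements are along a fixed (not relabelled) subsequence along which $\mu_n\rightharpoonup^*\hat\mu$ in $(L^\infty)^*\times(L^\infty)^*$, $p_n\rightharpoonup^*\hat p$ in $\mathcal V^*$ and $\lambda_n\rightharpoonup^*\hat\lambda=\hat p+\bar B^*\hat\mu$ in $\mathcal V^*$. Symmetric Bregman distance: $D^{symm}_{\mathcal J}(\bar u_{\mathcal J},u_n)=D^{p_n}_{\mathcal J}(\bar u_{\mathcal J},u_n)+D^{\hat p}_{\mathcal J}(u_n,\bar u_{\mathcal J})$ with $D^p_{\mathcal J}(v,u)=\mathcal J(v)-\mathcal J(u)-(p,v-u)$ for a subgradient $p$ of $\mathcal J$ at $u$; it equals $(p_n-\hat p,u_n-\bar u_{\mathcal J})$. Convergence assumption: there are sequences $\varepsilon_n\downarrow0$, $\eta_n\downarrow0$ and constants $C_0\geq1$, $D_0>0$ with $\varepsilon_n\mathbf 1\leq\phi_n-\bar\phi\leq C_0\varepsilon_n\mathbf 1$, $\|\bar B-B_n\|_{L^1\to L^\infty}\leq\eta_n$, and $\limsup_{n\to\infty}\eta_n/\varepsilon_n\leq D_0$. Source condition: there exists $\bar\mu\in(L^\infty)^*\times(L^\infty)^*$, $\bar\mu\geq0$, with $-\bar B^*\bar\mu\in\partial\mathcal J(\bar u_{\mathcal J})$. Non-empty interior assumption: $0$ is an interior point of $\partial\mathcal J(0)$ in the norm topology of $L^\infty$. *)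

theory Defs
  imports "HOL-Analysis.Analysis" "HOL-Probability.Essential_Supremum"
begin

text \<open>
  Elements of \<open>L\<^sup>1\<close> and \<open>L\<^sup>\<infinity>\<close> are represented by functions; an equivalence class modulo equality
  almost everywhere is never formed. Instead every operator and functional on such functions is
  required to respect almost everywhere equality, and equations and inequalities between elements
  of \<open>L\<^sup>1\<close> or \<open>L\<^sup>\<infinity>\<close> are stated almost everywhere.
\<close>

definition ae_le :: "'a measure \<Rightarrow> ('a \<Rightarrow> real) \<Rightarrow> ('a \<Rightarrow> real) \<Rightarrow> bool" where
  "ae_le M f g \<longleftrightarrow> (AE x in M. f x \<le> g x)"

definition ae_eq :: "'a measure \<Rightarrow> ('a \<Rightarrow> real) \<Rightarrow> ('a \<Rightarrow> real) \<Rightarrow> bool" where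
  "ae_eq M f g \<longleftrightarrow> (AE x in M. f x = g x)"

definition nonneg :: "'a measure \<Rightarrow> ('a \<Rightarrow> real) \<Rightarrow> bool" where
  "nonneg M f \<longleftrightarrow> ae_le M (\<lambda>_. 0) f"

definition L1 :: "'a measure \<Rightarrow> ('a \<Rightarrow> real) set" where
  "L1 M = {u. integrable M u}"

definition L1_norm :: "'a measure \<Rightarrow> ('a \<Rightarrow> real) \<Rightarrow> real" where
  "L1_norm M u = (\<integral>x. \<bar>u x\<bar> \<partial>M)"

definition Linf :: "'a measure \<Rightarrow> ('a \<Rightarrow> real) set" where
  "Linf M = {f \<in> borel_measurable M. esssup M (\<lambda>x. ereal \<bar>f x\<bar>) < \<infinity>}"

definition Linf_norm :: "'a measure \<Rightarrow> ('a \<Rightarrow> real) \<Rightarrow> real" where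
  "Linf_norm M f = real_of_ereal (esssup M (\<lambda>x. ereal \<bar>f x\<bar>))"

definition pairing :: "'a measure \<Rightarrow> ('a \<Rightarrow> real) \<Rightarrow> ('a \<Rightarrow> real) \<Rightarrow> real" where
  "pairing M p u = (\<integral>x. p x * u x \<partial>M)"


subsection \<open>Pairs in \<open>L\<^sup>\<infinity> \<times> L\<^sup>\<infinity>\<close>\<close>

type_synonym 'a fpair = "('a \<Rightarrow> real) \<times> ('a \<Rightarrow> real)"

definition pair_le :: "'a measure \<Rightarrow> 'a fpair \<Rightarrow> 'a fpair \<Rightarrow> bool" where
  "pair_le M \<phi> \<psi> \<longleftrightarrow> ae_le M (fst \<phi>) (fst \<psi>) \<and> ae_le M (snd \<phi>) (snd \<psi>)"

definition pair_diff :: "'a fpair \<Rightarrow> 'a fpair \<Rightarrow> 'a fpair" where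
  "pair_diff \<phi> \<psi> = ((\<lambda>x. fst \<phi> x - fst \<psi> x), (\<lambda>x. snd \<phi> x - snd \<psi> x))"

definition pair_uminus :: "'a fpair \<Rightarrow> 'a fpair" where
  "pair_uminus \<phi> = ((\<lambda>x. - fst \<phi> x), (\<lambda>x. - snd \<phi> x))"

definition pair_const :: "real \<Rightarrow> 'a fpair" where
  "pair_const c = ((\<lambda>_. c), (\<lambda>_. c))"

text \<open>The maximum norm on the product; its dual norm on \<open>(L\<^sup>\<infinity>)\<^sup>* \<times> (L\<^sup>\<infinity>)\<^sup>*\<close> is the sum norm used below.\<close>

definition pair_norm :: "'a measure \<Rightarrow> 'a fpair \<Rightarrow> real" where
  "pair_norm M \<phi> = max (Linf_norm M (fst \<phi>)) (Linf_norm M (snd \<phi>))"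


subsection \<open>Linear operators from \<open>L\<^sup>1\<close> to \<open>L\<^sup>\<infinity>\<close>\<close>

definition linear_op :: "'a measure \<Rightarrow> (('a \<Rightarrow> real) \<Rightarrow> ('a \<Rightarrow> real)) \<Rightarrow> bool" where
  "linear_op M T \<longleftrightarrow>
     (\<forall>u\<in>L1 M. T u \<in> Linf M) \<and>
     (\<forall>u\<in>L1 M. \<forall>v\<in>L1 M. ae_eq M u v \<longrightarrow> ae_eq M (T u) (T v)) \<and>
     (\<forall>u\<in>L1 M. \<forall>v\<in>L1 M. \<forall>a b. ae_eq M (T (\<lambda>x. a * u x + b * v x)) (\<lambda>x. a * T u x + b * T v x))"

definition positive_op :: "'a measure \<Rightarrow> (('a \<Rightarrow> real) \<Rightarrow> ('a \<Rightarrow> real)) \<Rightarrow> bool" where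
  "positive_op M T \<longleftrightarrow> linear_op M T \<and> (\<forall>u\<in>L1 M. nonneg M u \<longrightarrow> nonneg M (T u))"

definition regular_op :: "'a measure \<Rightarrow> (('a \<Rightarrow> real) \<Rightarrow> ('a \<Rightarrow> real)) \<Rightarrow> bool" where
  "regular_op M T \<longleftrightarrow> linear_op M T \<and>
     (\<exists>P Q. positive_op M P \<and> positive_op M Q \<and> (\<forall>u\<in>L1 M. ae_eq M (T u) (\<lambda>x. P u x - Q u x)))"

definition op_le ::
  "'a measure \<Rightarrow> (('a \<Rightarrow> real) \<Rightarrow> ('a \<Rightarrow> real)) \<Rightarrow> (('a \<Rightarrow> real) \<Rightarrow> ('a \<Rightarrow> real)) \<Rightarrow> bool" where
  "op_le M T S \<longleftrightarrow> (\<forall>u\<in>L1 M. nonneg M u \<longrightarrow> nonneg M (\<lambda>x. S u x - T u x))"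

text \<open>The operator norms are extended reals, so that an unbounded operator has norm \<open>\<infinity>\<close>.\<close>

definition op_norm :: "'a measure \<Rightarrow> (('a \<Rightarrow> real) \<Rightarrow> ('a \<Rightarrow> real)) \<Rightarrow> ereal" where
  "op_norm M T = (SUP u\<in>{u \<in> L1 M. L1_norm M u \<le> 1}. ereal (Linf_norm M (T u)))"

definition pair_op_norm :: "'a measure \<Rightarrow> (('a \<Rightarrow> real) \<Rightarrow> 'a fpair) \<Rightarrow> ereal" where
  "pair_op_norm M B = (SUP u\<in>{u \<in> L1 M. L1_norm M u \<le> 1}. ereal (pair_norm M (B u)))"

text \<open>
  \<open>B\<^sub>n = constraint_op (A\<^sup>l\<^sub>n) (A\<^sup>u\<^sub>n)\<close> and \<open>\<phi>\<^sub>n = constraint_rhs (f\<^sup>l\<^sub>n) (f\<^sup>u\<^sub>n)\<close>; the exact data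
  correspond to \<open>constraint_op A A\<close> and \<open>constraint_rhs f f\<close>.
\<close>

definition constraint_op ::
  "(('a \<Rightarrow> real) \<Rightarrow> ('a \<Rightarrow> real)) \<Rightarrow> (('a \<Rightarrow> real) \<Rightarrow> ('a \<Rightarrow> real)) \<Rightarrow> ('a \<Rightarrow> real) \<Rightarrow> 'a fpair" where
  "constraint_op Al Au u = (Al u, (\<lambda>x. - Au u x))"

definition constraint_rhs :: "('a \<Rightarrow> real) \<Rightarrow> ('a \<Rightarrow> real) \<Rightarrow> 'a fpair" where
  "constraint_rhs fl fu = (fu, (\<lambda>x. - fl x))"


subsection \<open>The dual of \<open>L\<^sup>\<infinity>\<close>\<close>

text \<open>
  Functionals are only constrained on \<open>Linf M\<close>. Linearity and boundedness imply that they respect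
  almost everywhere equality.
\<close>

definition Linf_dual :: "'a measure \<Rightarrow> (('a \<Rightarrow> real) \<Rightarrow> real) set" where
  "Linf_dual M = {\<mu>.
     (\<forall>\<phi>\<in>Linf M. \<forall>\<psi>\<in>Linf M. \<forall>a b. \<mu> (\<lambda>x. a * \<phi> x + b * \<psi> x) = a * \<mu> \<phi> + b * \<mu> \<psi>) \<and>
     (\<exists>K. \<forall>\<psi>\<in>Linf M. \<bar>\<mu> \<psi>\<bar> \<le> K * Linf_norm M \<psi>)}"

definition Linf_dual_norm :: "'a measure \<Rightarrow> (('a \<Rightarrow> real) \<Rightarrow> real) \<Rightarrow> real" where
  "Linf_dual_norm M \<mu> = (SUP \<psi>\<in>{\<psi> \<in> Linf M. Linf_norm M \<psi> \<le> 1}. \<bar>\<mu> \<psi>\<bar>)"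

definition Linf_dual_nonneg :: "'a measure \<Rightarrow> (('a \<Rightarrow> real) \<Rightarrow> real) \<Rightarrow> bool" where
  "Linf_dual_nonneg M \<mu> \<longleftrightarrow> (\<forall>\<psi>\<in>Linf M. nonneg M \<psi> \<longrightarrow> 0 \<le> \<mu> \<psi>)"

type_synonym 'a dpair = "(('a \<Rightarrow> real) \<Rightarrow> real) \<times> (('a \<Rightarrow> real) \<Rightarrow> real)"

definition dual_pairs :: "'a measure \<Rightarrow> 'a dpair set" where
  "dual_pairs M = Linf_dual M \<times> Linf_dual M"

definition dpair_nonneg :: "'a measure \<Rightarrow> 'a dpair \<Rightarrow> bool" where
  "dpair_nonneg M \<mu> \<longleftrightarrow> Linf_dual_nonneg M (fst \<mu>) \<and> Linf_dual_nonneg M (snd \<mu>)"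

definition dpair_norm :: "'a measure \<Rightarrow> 'a dpair \<Rightarrow> real" where
  "dpair_norm M \<mu> = Linf_dual_norm M (fst \<mu>) + Linf_dual_norm M (snd \<mu>)"

definition dpairing :: "'a dpair \<Rightarrow> 'a fpair \<Rightarrow> real" where
  "dpairing \<mu> \<psi> = fst \<mu> (fst \<psi>) + snd \<mu> (snd \<psi>)"

text \<open>
  The adjoint \<open>B\<^sup>* \<mu>\<close> is the element of \<open>L\<^sup>\<infinity>\<close> representing the functional \<open>v \<mapsto> (\<mu>, B v)\<close> on \<open>L\<^sup>1\<close>. It is
  determined up to equality almost everywhere, and \<open>SOME\<close> picks a representative.
\<close>

definition adjoint_op ::
  "'a measure \<Rightarrow> (('a \<Rightarrow> real) \<Rightarrow> 'a fpair) \<Rightarrow> 'a dpair \<Rightarrow> ('a \<Rightarrow> real)" where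
  "adjoint_op M B \<mu> = (SOME q. q \<in> Linf M \<and> (\<forall>v\<in>L1 M. pairing M q v = dpairing \<mu> (B v)))"


subsection \<open>The regularisation functional\<close>

definition regulariser :: "'a measure \<Rightarrow> (('a \<Rightarrow> real) \<Rightarrow> ereal) \<Rightarrow> bool" where
  "regulariser M J \<longleftrightarrow>
     (\<forall>u\<in>L1 M. 0 \<le> J u) \<and>
     (\<forall>u\<in>L1 M. \<forall>v\<in>L1 M. ae_eq M u v \<longrightarrow> J u = J v) \<and>
     (\<forall>u\<in>L1 M. \<forall>v\<in>L1 M. \<forall>t\<in>{0..1}.
        J (\<lambda>x. t * u x + (1 - t) * v x) \<le> ereal t * J u + ereal (1 - t) * J v) \<and>
     (\<exists>u\<in>L1 M. J u < \<infinity>) \<and>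
     (\<forall>u\<in>L1 M. \<forall>t. J (\<lambda>x. t * u x) = ereal \<bar>t\<bar> * J u)"

definition subdifferential ::
  "'a measure \<Rightarrow> (('a \<Rightarrow> real) \<Rightarrow> ereal) \<Rightarrow> ('a \<Rightarrow> real) \<Rightarrow> ('a \<Rightarrow> real) set" where
  "subdifferential M J u =
     {p \<in> Linf M. (\<forall>v\<in>L1 M. ereal (pairing M p v) \<le> J v) \<and> J u = ereal (pairing M p u)}"

definition finite_domain :: "'a measure \<Rightarrow> (('a \<Rightarrow> real) \<Rightarrow> ereal) \<Rightarrow> ('a \<Rightarrow> real) set" where
  "finite_domain M J = {u \<in> L1 M. J u < \<infinity>}"

text \<open>The dual of \<open>V = finite_domain M J\<close> normed by \<open>J\<close>; functionals are only constrained on \<open>V\<close>.\<close>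

definition domain_dual :: "'a measure \<Rightarrow> (('a \<Rightarrow> real) \<Rightarrow> ereal) \<Rightarrow> (('a \<Rightarrow> real) \<Rightarrow> real) set" where
  "domain_dual M J = {p.
     (\<forall>u\<in>finite_domain M J. \<forall>v\<in>finite_domain M J. \<forall>a b.
        p (\<lambda>x. a * u x + b * v x) = a * p u + b * p v) \<and>
     (\<exists>K. \<forall>v\<in>finite_domain M J. \<bar>p v\<bar> \<le> K * real_of_ereal (J v))}"

definition bregman ::
  "(('a \<Rightarrow> real) \<Rightarrow> ereal) \<Rightarrow> (('a \<Rightarrow> real) \<Rightarrow> real) \<Rightarrow> ('a \<Rightarrow> real) \<Rightarrow> ('a \<Rightarrow> real) \<Rightarrow> ereal" where
  "bregman J p v u = J v - J u - ereal (p (\<lambda>x. v x - u x))"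

text \<open>Here \<open>p\<close> is the subgradient at \<open>u\<close> and \<open>q\<close> the one at \<open>v\<close>.\<close>

definition bregman_symm ::
  "(('a \<Rightarrow> real) \<Rightarrow> ereal) \<Rightarrow> (('a \<Rightarrow> real) \<Rightarrow> real) \<Rightarrow> (('a \<Rightarrow> real) \<Rightarrow> real) \<Rightarrow>
    ('a \<Rightarrow> real) \<Rightarrow> ('a \<Rightarrow> real) \<Rightarrow> ereal" where
  "bregman_symm J p q v u = bregman J p v u + bregman J q u v"


subsection \<open>Primal and dual problems\<close>

definition J_minimising_solution ::
  "'a measure \<Rightarrow> (('a \<Rightarrow> real) \<Rightarrow> ereal) \<Rightarrow> (('a \<Rightarrow> real) \<Rightarrow> ('a \<Rightarrow> real)) \<Rightarrow> ('a \<Rightarrow> real) \<Rightarrow>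
    ('a \<Rightarrow> real) \<Rightarrow> bool" where
  "J_minimising_solution M J A f u \<longleftrightarrow>
     is_arg_min J (\<lambda>u. u \<in> L1 M \<and> nonneg M u \<and> ae_eq M (A u) f) u"

definition primal_solution ::
  "'a measure \<Rightarrow> (('a \<Rightarrow> real) \<Rightarrow> ereal) \<Rightarrow> (('a \<Rightarrow> real) \<Rightarrow> 'a fpair) \<Rightarrow> 'a fpair \<Rightarrow>
    ('a \<Rightarrow> real) \<Rightarrow> bool" where
  "primal_solution M J B \<phi> u \<longleftrightarrow>
     is_arg_min J (\<lambda>u. u \<in> L1 M \<and> nonneg M u \<and> pair_le M (B u) \<phi>) u"

definition dual_solution ::
  "'a measure \<Rightarrow> (('a \<Rightarrow> real) \<Rightarrow> ereal) \<Rightarrow> (('a \<Rightarrow> real) \<Rightarrow> 'a fpair) \<Rightarrow> 'a fpair \<Rightarrow>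
    ('a \<Rightarrow> real) \<Rightarrow> 'a dpair \<Rightarrow> bool" where
  "dual_solution M J B \<phi> lam \<mu> \<longleftrightarrow>
     is_arg_max (\<lambda>(lam, \<mu>). dpairing \<mu> (pair_uminus \<phi>))
       (\<lambda>(lam, \<mu>). lam \<in> Linf M \<and> nonneg M lam \<and> \<mu> \<in> dual_pairs M \<and> dpair_nonneg M \<mu> \<and>
          (\<lambda>x. lam x - adjoint_op M B \<mu> x) \<in> subdifferential M J (\<lambda>_. 0))
       (lam, \<mu>)"


subsection \<open>Assumptions\<close>

definition data_bounds ::
  "'a measure \<Rightarrow> ('a \<Rightarrow> real) \<Rightarrow> (nat \<Rightarrow> 'a \<Rightarrow> real) \<Rightarrow> (nat \<Rightarrow> 'a \<Rightarrow> real) \<Rightarrow> bool" where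
  "data_bounds M f fl fu \<longleftrightarrow>
     f \<in> Linf M \<and>
     (\<forall>n. fl n \<in> Linf M \<and> fu n \<in> Linf M \<and>
          ae_le M (fl n) f \<and> ae_le M f (fu n) \<and>
          ae_le M (fl n) (fl (Suc n)) \<and> ae_le M (fu (Suc n)) (fu n)) \<and>
     (\<lambda>n. Linf_norm M (\<lambda>x. fu n x - fl n x)) \<longlonglongrightarrow> 0"

text \<open>Regularity of \<open>A\<close> itself follows from that of its bounds.\<close>

definition operator_bounds ::
  "'a measure \<Rightarrow> (('a \<Rightarrow> real) \<Rightarrow> ('a \<Rightarrow> real)) \<Rightarrow> (nat \<Rightarrow> ('a \<Rightarrow> real) \<Rightarrow> ('a \<Rightarrow> real)) \<Rightarrow>
    (nat \<Rightarrow> ('a \<Rightarrow> real) \<Rightarrow> ('a \<Rightarrow> real)) \<Rightarrow> bool" where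
  "operator_bounds M A Al Au \<longleftrightarrow>
     linear_op M A \<and>
     (\<forall>n. regular_op M (Al n) \<and> regular_op M (Au n) \<and>
          op_le M (Al n) A \<and> op_le M A (Au n) \<and>
          op_le M (Al n) (Al (Suc n)) \<and> op_le M (Au (Suc n)) (Au n)) \<and>
     (\<lambda>n. op_norm M (\<lambda>u x. Au n u x - Al n u x)) \<longlonglongrightarrow> 0"

definition convergence_assumption ::
  "'a measure \<Rightarrow> (('a \<Rightarrow> real) \<Rightarrow> 'a fpair) \<Rightarrow> 'a fpair \<Rightarrow> (nat \<Rightarrow> ('a \<Rightarrow> real) \<Rightarrow> 'a fpair) \<Rightarrow>
    (nat \<Rightarrow> 'a fpair) \<Rightarrow> (nat \<Rightarrow> real) \<Rightarrow> (nat \<Rightarrow> real) \<Rightarrow> real \<Rightarrow> real \<Rightarrow> bool" where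
  "convergence_assumption M Bbar phibar B phi \<epsilon> \<eta> C0 D0 \<longleftrightarrow>
     (\<forall>n. 0 < \<epsilon> n) \<and> decseq \<epsilon> \<and> \<epsilon> \<longlonglongrightarrow> 0 \<and> decseq \<eta> \<and> \<eta> \<longlonglongrightarrow> 0 \<and> 1 \<le> C0 \<and> 0 < D0 \<and>
     (\<forall>n. pair_le M (pair_const (\<epsilon> n)) (pair_diff (phi n) phibar) \<and>
          pair_le M (pair_diff (phi n) phibar) (pair_const (C0 * \<epsilon> n)) \<and>
          pair_op_norm M (\<lambda>u. pair_diff (Bbar u) (B n u)) \<le> ereal (\<eta> n)) \<and>
     limsup (\<lambda>n. ereal (\<eta> n / \<epsilon> n)) \<le> ereal D0"

definition source_condition ::
  "'a measure \<Rightarrow> (('a \<Rightarrow> real) \<Rightarrow> ereal) \<Rightarrow> (('a \<Rightarrow> real) \<Rightarrow> 'a fpair) \<Rightarrow> ('a \<Rightarrow> real) \<Rightarrow>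
    'a dpair \<Rightarrow> bool" where
  "source_condition M J Bbar ubar mubar \<longleftrightarrow>
     mubar \<in> dual_pairs M \<and> dpair_nonneg M mubar \<and>
     (\<lambda>x. - adjoint_op M Bbar mubar x) \<in> subdifferential M J ubar"

definition nonempty_interior :: "'a measure \<Rightarrow> (('a \<Rightarrow> real) \<Rightarrow> ereal) \<Rightarrow> bool" where
  "nonempty_interior M J \<longleftrightarrow>
     (\<exists>\<delta>>0. \<forall>p\<in>Linf M. Linf_norm M p < \<delta> \<longrightarrow> p \<in> subdifferential M J (\<lambda>_. 0))"

text \<open>
  Weak-* convergence along the subsequence \<open>r\<close>. The functions \<open>p n\<close> and \<open>lam n\<close> in \<open>L\<^sup>\<infinity>\<close> act on
  \<open>finite_domain M J\<close> through \<open>pairing M\<close>.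
\<close>

definition limit_subgradient ::
  "'a measure \<Rightarrow> (('a \<Rightarrow> real) \<Rightarrow> ereal) \<Rightarrow> (('a \<Rightarrow> real) \<Rightarrow> 'a fpair) \<Rightarrow> (nat \<Rightarrow> nat) \<Rightarrow>
    (nat \<Rightarrow> 'a dpair) \<Rightarrow> (nat \<Rightarrow> 'a \<Rightarrow> real) \<Rightarrow> (nat \<Rightarrow> 'a \<Rightarrow> real) \<Rightarrow>
    'a dpair \<Rightarrow> (('a \<Rightarrow> real) \<Rightarrow> real) \<Rightarrow> bool" where
  "limit_subgradient M J Bbar r mu p lam muhat phat \<longleftrightarrow>
     strict_mono r \<and> muhat \<in> dual_pairs M \<and> phat \<in> domain_dual M J \<and>
     (\<forall>\<psi> \<in> Linf M \<times> Linf M. (\<lambda>k. dpairing (mu (r k)) \<psi>) \<longlonglongrightarrow> dpairing muhat \<psi>) \<and>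
     (\<forall>v \<in> finite_domain M J. (\<lambda>k. pairing M (p (r k)) v) \<longlonglongrightarrow> phat v) \<and>
     (\<forall>v \<in> finite_domain M J.
        (\<lambda>k. pairing M (lam (r k)) v) \<longlonglongrightarrow> phat v + pairing M (adjoint_op M Bbar muhat) v)"

end

theory Submission
  imports Defs
begin

text \<open>
  Write \<open>J\<^sup>\<star>\<close> for the minimal value of \<open>J\<close> over exact solutions, \<open>u\<close> for an exact minimiser, \<open>m\<close> for the
  mass \<open>(\<mu>bar, 1)\<close> of the source element, and \<open>K = C\<^sub>0 + D J\<^sup>\<star> / \<delta>\<close>, where \<open>D\<close> bounds all ratios
  \<open>\<eta>\<^sub>n / \<epsilon>\<^sub>n\<close> and \<open>\<delta>\<close> is the coercivity constant below. The difficulty is that the primal and the perturbed dual problem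
  come with no equality of their values. A bound of the duality gap of order \<open>\<epsilon>\<^sub>n\<close> is enough, and the source
  condition provides it.

  The interior point assumption makes \<open>J\<close> coercive, \<open>J v \<ge> \<delta> \<parallel>v\<parallel>\<^sub>1\<close> (\<open>regulariser_coercive\<close>). The source
  condition says \<open>-(\<mu>bar, Bbar v) \<le> J v\<close> with equality at \<open>u\<close>. Passing from \<open>Bbar\<close> to \<open>B\<^sub>n\<close> adds an error of
  order \<open>\<epsilon>\<^sub>n m \<parallel>v\<parallel>\<^sub>1\<close>, hence a small multiple of \<open>J v\<close>, so that \<open>\<mu>bar\<close> divided by one plus this multiple is
  feasible in the perturbed dual problem. Comparing values shows that the optimal dual value
  \<open>(\<mu>\<^sub>n, -\<phi>\<^sub>n)\<close> is at least \<open>J\<^sup>\<star> - K \<epsilon>\<^sub>n m\<close> (\<open>dual_value_lower_bound\<close>).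

  Since \<open>\<phi>\<^sub>n\<close> exceeds the exact right-hand side by \<open>\<epsilon>\<^sub>n\<close>, the perturbed subgradient satisfies
  \<open>(p\<^sub>n, u) \<ge> (\<mu>\<^sub>n, -\<phi>\<^sub>n) + \<epsilon>\<^sub>n (\<mu>\<^sub>n, 1)\<close>. Together with \<open>(p\<^sub>n, u) \<le> J\<^sup>\<star>\<close> this yields the uniform bound
  \<open>(\<mu>\<^sub>n, 1) \<le> K m\<close> (\<open>dual_mass_bound\<close>), and together with \<open>(p\<^sub>n, u\<^sub>n) \<le> J u\<^sub>n \<le> J\<^sup>\<star>\<close> it bounds
  \<open>(p\<^sub>n, u\<^sub>n - u)\<close> by \<open>K \<epsilon>\<^sub>n m\<close> (\<open>dual_subgradient_increment\<close>).

  For the limit subgradient, \<open>phat u \<le> J\<^sup>\<star>\<close>. As the limit of the multipliers of the sign constraint is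
  nonnegative, \<open>phat u\<^sub>n \<ge> -(\<mu>hat, Bbar u\<^sub>n)\<close>; the constraint \<open>B\<^sub>n u\<^sub>n \<le> \<phi>\<^sub>n\<close>, coercivity and the limit of the
  dual bound give \<open>phat u\<^sub>n \<ge> J\<^sup>\<star> - K \<epsilon>\<^sub>n (\<mu>hat, 1)\<close>, where \<open>(\<mu>hat, 1) \<le> K m\<close>. Adding both halves gives the
  constant \<open>K + K\<^sup>2\<close> (\<open>bregman_symm_estimate\<close>).

  All of this evaluates adjoints on functions, so representatives of the adjoints in \<open>L\<^sup>\<infinity>\<close> must exist.
  This is where regularity enters: a positive operator followed by a nonnegative functional is a
  positive functional on \<open>L\<^sup>1\<close>, which is automatically bounded and is represented by a bounded density
  (\<open>positive_functional_represented\<close>, \<open>adjoint_constraint_op\<close>).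
\<close>

section \<open>Essentially bounded and integrable functions\<close>

text \<open>
  Membership in \<open>L\<^sup>\<infinity>\<close> without the extended real valued essential supremum; sums and products are
  easier to bound in this form.
\<close>

lemma Linf_iff_AE_bounded:
  "f \<in> Linf M \<longleftrightarrow> f \<in> borel_measurable M \<and> (\<exists>c. AE x in M. \<bar>f x\<bar> \<le> c)"
proof
  assume f: "f \<in> Linf M"
  then have "esssup M (\<lambda>x. ereal \<bar>f x\<bar>) < \<infinity>" by (simp add: Linf_def)
  then obtain c where "esssup M (\<lambda>x. ereal \<bar>f x\<bar>) \<le> ereal c"
    by (metis ereal_top less_le_not_le linear less_irrefl)
  then have le: "t \<le> ereal c" if "t \<le> esssup M (\<lambda>x. ereal \<bar>f x\<bar>)" for t
    using that order_trans by blast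
  have "AE x in M. ereal \<bar>f x\<bar> \<le> esssup M (\<lambda>x. ereal \<bar>f x\<bar>)"
    by (rule esssup_AE)
  then have "AE x in M. ereal \<bar>f x\<bar> \<le> ereal c"
    by eventually_elim (rule le)
  then show "f \<in> borel_measurable M \<and> (\<exists>c. AE x in M. \<bar>f x\<bar> \<le> c)"
    using f by (auto simp: Linf_def)
next
  assume "f \<in> borel_measurable M \<and> (\<exists>c. AE x in M. \<bar>f x\<bar> \<le> c)"
  then obtain c where f: "f \<in> borel_measurable M" and c: "AE x in M. \<bar>f x\<bar> \<le> c" by auto
  have "esssup M (\<lambda>x. ereal \<bar>f x\<bar>) \<le> ereal c"
    by (rule esssup_I) (use f c in auto)
  then show "f \<in> Linf M" using f by (auto simp: Linf_def)
qed

lemma AE_abs_le_Linf_norm: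
  assumes f: "f \<in> Linf M"
  shows "AE x in M. \<bar>f x\<bar> \<le> Linf_norm M f"
proof -
  have ae: "AE x in M. ereal \<bar>f x\<bar> \<le> esssup M (\<lambda>x. ereal \<bar>f x\<bar>)"
    by (rule esssup_AE)
  show ?thesis
  proof (cases "esssup M (\<lambda>x. ereal \<bar>f x\<bar>)")
    case (real c)
    then show ?thesis using ae by (simp add: Linf_norm_def)
  next
    case PInf
    then show ?thesis using f by (simp add: Linf_def)
  next
    case MInf
    then show ?thesis using ae by (auto elim: eventually_mono)
  qed
qed

lemma Linf_norm_le:
  assumes "f \<in> borel_measurable M" "AE x in M. \<bar>f x\<bar> \<le> c" "0 \<le> c"
  shows "Linf_norm M f \<le> c"
proof -
  have "esssup M (\<lambda>x. ereal \<bar>f x\<bar>) \<le> ereal c"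
    by (rule esssup_I) (use assms in auto)
  then show ?thesis
    using assms(3) by (cases "esssup M (\<lambda>x. ereal \<bar>f x\<bar>)") (auto simp: Linf_norm_def)
qed

lemma Linf_norm_nonneg:
  assumes f: "f \<in> Linf M"
  shows "0 \<le> Linf_norm M f"
proof (rule ccontr)
  assume neg: "\<not> ?thesis"
  \<comment> \<open>A negative bound for absolute values is possible only on a null space, where the essential
    supremum is \<open>- \<infinity>\<close> and its real value is \<open>0\<close>.\<close>
  then have "AE x in M. False"
    using AE_abs_le_Linf_norm[OF f] by (auto elim!: eventually_mono)
  then have "esssup M (\<lambda>x. ereal \<bar>f x\<bar>) \<le> - \<infinity>"
    using f by (intro esssup_I) (auto simp: Linf_def elim: eventually_mono)
  then show False using neg by (simp add: Linf_norm_def)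
qed

lemma Linf_linear_comb:
  assumes "f \<in> Linf M" "g \<in> Linf M"
  shows "(\<lambda>x. a * f x + b * g x) \<in> Linf M"
proof -
  from assms obtain c d where "AE x in M. \<bar>f x\<bar> \<le> c" "AE x in M. \<bar>g x\<bar> \<le> d"
    by (auto simp: Linf_iff_AE_bounded)
  then have "AE x in M. \<bar>a * f x + b * g x\<bar> \<le> \<bar>a\<bar> * c + \<bar>b\<bar> * d"
  proof eventually_elim
    case (elim x)
    have "\<bar>a * f x + b * g x\<bar> \<le> \<bar>a\<bar> * \<bar>f x\<bar> + \<bar>b\<bar> * \<bar>g x\<bar>"
      by (metis abs_mult abs_triangle_ineq)
    also have "\<dots> \<le> \<bar>a\<bar> * c + \<bar>b\<bar> * d"
      using elim by (intro add_mono mult_left_mono) auto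
    finally show ?case .
  qed
  then show ?thesis using assms by (auto simp: Linf_iff_AE_bounded)
qed

lemma Linf_const: "(\<lambda>_. c) \<in> Linf M"
  by (auto simp: Linf_iff_AE_bounded)

lemma Linf_uminus: "f \<in> Linf M \<Longrightarrow> (\<lambda>x. - f x) \<in> Linf M"
  using Linf_linear_comb[of f M f "-1" 0] by simp

lemma Linf_diff: "f \<in> Linf M \<Longrightarrow> g \<in> Linf M \<Longrightarrow> (\<lambda>x. f x - g x) \<in> Linf M"
  using Linf_linear_comb[of f M g 1 "-1"] by simp

lemma L1_linear_comb: "u \<in> L1 M \<Longrightarrow> v \<in> L1 M \<Longrightarrow> (\<lambda>x. a * u x + b * v x) \<in> L1 M"
  by (simp add: L1_def)

lemma L1_norm_nonneg: "0 \<le> L1_norm M u"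
  by (simp add: L1_norm_def)

section \<open>Positive functionals on integrable functions\<close>

definition positive_functional :: "'a measure \<Rightarrow> (('a \<Rightarrow> real) \<Rightarrow> real) \<Rightarrow> bool" where
  "positive_functional M F \<longleftrightarrow>
     (\<forall>u\<in>L1 M. \<forall>v\<in>L1 M. \<forall>a b. F (\<lambda>x. a * u x + b * v x) = a * F u + b * F v) \<and>
     (\<forall>u\<in>L1 M. nonneg M u \<longrightarrow> 0 \<le> F u)"

context
  fixes M :: "'a measure" and F :: "('a \<Rightarrow> real) \<Rightarrow> real"
  assumes F: "positive_functional M F"
begin

lemma positive_functional_lin: "integrable M u \<Longrightarrow> integrable M v \<Longrightarrow> F (\<lambda>x. a * u x + b * v x) = a * F u + b * F v"
  using F by (simp add: positive_functional_def L1_def)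

lemma positive_functional_nonneg: "integrable M u \<Longrightarrow> AE x in M. 0 \<le> u x \<Longrightarrow> 0 \<le> F u"
  using F by (simp add: positive_functional_def L1_def nonneg_def ae_le_def)

lemma positive_functional_scale: "integrable M u \<Longrightarrow> F (\<lambda>x. a * u x) = a * F u"
  using positive_functional_lin[of u u a 0] by simp

lemma positive_functional_add: "integrable M u \<Longrightarrow> integrable M v \<Longrightarrow> F (\<lambda>x. u x + v x) = F u + F v"
  using positive_functional_lin[of u v 1 1] by simp

lemma positive_functional_diff: "integrable M u \<Longrightarrow> integrable M v \<Longrightarrow> F (\<lambda>x. u x - v x) = F u - F v"
  using positive_functional_lin[of u v 1 "-1"] by simp

lemma positive_functional_mono:
  "integrable M u \<Longrightarrow> integrable M v \<Longrightarrow> AE x in M. u x \<le> v x \<Longrightarrow> F u \<le> F v"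
  using positive_functional_nonneg[of "\<lambda>x. v x - u x"] positive_functional_diff[of v u] by simp

text \<open>
  Positivity alone forces boundedness: otherwise there are \<open>w\<^sub>k \<ge> 0\<close> with norm \<open>2\<^sup>-\<^sup>k\<close> and
  \<open>F w\<^sub>k > 2\<^sup>k\<close>, and their sum is an integrable function that dominates every \<open>w\<^sub>k\<close>, so that \<open>F\<close> would
  have no finite value there.
\<close>

lemma positive_functional_bounded_nonneg: "\<exists>c\<ge>0. \<forall>u. integrable M u \<longrightarrow> (\<forall>x. 0 \<le> u x) \<longrightarrow> F u \<le> c * integral\<^sup>L M u"
proof (rule ccontr)
  assume *: "\<not> ?thesis"
  have "\<exists>w. integrable M w \<and> (\<forall>x. 0 \<le> w x) \<and> integral\<^sup>L M w = (1/2)^k \<and> 2^k < F w" for k :: nat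
  proof -
    have "\<not> (\<forall>u. integrable M u \<longrightarrow> (\<forall>x. 0 \<le> u x) \<longrightarrow> F u \<le> 4^k * integral\<^sup>L M u)"
      using * by (metis zero_le_numeral zero_le_power)
    then obtain u where u: "integrable M u" "\<And>x. 0 \<le> u x" "4^k * integral\<^sup>L M u < F u"
      by (auto simp: not_le)
    have pos: "0 < integral\<^sup>L M u"
    proof (rule ccontr)
      assume "\<not> ?thesis"
      moreover have "0 \<le> integral\<^sup>L M u" using u by simp
      ultimately have z: "integral\<^sup>L M u = 0" by simp
      then have "AE x in M. u x = 0" using integral_nonneg_eq_0_iff_AE[OF u(1)] u(2) by auto
      then have "F u \<le> F (\<lambda>x. 0)" by (intro positive_functional_mono) (use u in auto)
      also have "F (\<lambda>x. 0) = 0" using positive_functional_scale[of u 0] u by simp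
      finally show False using u z by simp
    qed
    \<comment> \<open>The factor \<open>t\<close> rescales \<open>u\<close> to norm \<open>2\<^sup>-\<^sup>k\<close>; since \<open>F u\<close> exceeds \<open>4\<^sup>k\<close> times the norm, the
      value of \<open>F\<close> stays above \<open>2\<^sup>k\<close>.\<close>
    define t where "t = (1/2)^k / integral\<^sup>L M u"
    have "t > 0" using pos by (simp add: t_def)
    have "t * (4^k * integral\<^sup>L M u) = (2::real)^k"
      using pos by (simp add: t_def field_simps power_mult_distrib[symmetric])
    then have "2^k < t * F u" using u(3) \<open>t > 0\<close> by (metis mult_strict_left_mono)
    then show ?thesis
      using u pos \<open>t > 0\<close> positive_functional_scale[OF u(1), of t]
      by (intro exI[of _ "\<lambda>x. t * u x"]) (auto simp: t_def)
  qed
  then obtain w where w: "\<And>k. integrable M (w k)" "\<And>k x. 0 \<le> w k x"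
    "\<And>k. integral\<^sup>L M (w k) = (1/2)^k" "\<And>k::nat. 2^k < F (w k)" by metis
  define g where "g x = (\<Sum>k. ennreal (w k x))" for x
  have [measurable]: "w k \<in> borel_measurable M" for k using w(1) by auto
  have g[measurable]: "g \<in> borel_measurable M" unfolding g_def[abs_def] by measurable
  have "(\<integral>\<^sup>+x. g x \<partial>M) = (\<Sum>k. \<integral>\<^sup>+x. ennreal (w k x) \<partial>M)"
    unfolding g_def by (rule nn_integral_suminf) simp
  also have "\<dots> = (\<Sum>k. ennreal ((1/2)^k))"
    by (simp add: nn_integral_eq_integral w)
  also have "\<dots> < \<infinity>"
    by (subst suminf_ennreal2) (auto simp: summable_geometric)
  finally have fin: "(\<integral>\<^sup>+x. g x \<partial>M) < \<infinity>" .
  then have gfin: "AE x in M. g x \<noteq> \<infinity>" by (intro nn_integral_PInf_AE) auto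
  define v where "v x = enn2real (g x)" for x
  have v: "integrable M v"
  proof (rule integrableI_nonneg)
    have "(\<integral>\<^sup>+x. ennreal (v x) \<partial>M) = (\<integral>\<^sup>+x. g x \<partial>M)"
      by (rule nn_integral_cong_AE)
        (use gfin in \<open>auto simp: v_def less_top elim: eventually_mono\<close>)
    then show "(\<integral>\<^sup>+x. ennreal (v x) \<partial>M) < \<infinity>" using fin by simp
    show "v \<in> borel_measurable M" unfolding v_def[abs_def] by measurable
  qed (simp add: v_def)
  have "2^k < F v" for k :: nat
  proof -
    have "AE x in M. w k x \<le> v x"
      using gfin
    proof eventually_elim
      case (elim x)
      have "ennreal (w k x) \<le> g x"
        unfolding g_def using sum_le_suminf[of "\<lambda>k. ennreal (w k x)" "{k}"] by simp
      then have "enn2real (ennreal (w k x)) \<le> v x"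
        unfolding v_def using elim by (intro enn2real_mono) (auto simp: less_top)
      then show ?case using w(2) by simp
    qed
    then have "F (w k) \<le> F v" by (intro positive_functional_mono v w)
    then show ?thesis using w(4)[of k] by simp
  qed
  moreover obtain k :: nat where "F v < 2^k" using real_arch_pow[of 2 "F v"] by auto
  ultimately show False by (meson less_asym)
qed

lemma positive_functional_bounded: "\<exists>c\<ge>0. \<forall>u. integrable M u \<longrightarrow> \<bar>F u\<bar> \<le> c * L1_norm M u"
proof -
  obtain c where c: "c \<ge> 0" "\<And>u. integrable M u \<Longrightarrow> (\<And>x. 0 \<le> u x) \<Longrightarrow> F u \<le> c * integral\<^sup>L M u"
    using positive_functional_bounded_nonneg by blast
  have "\<bar>F u\<bar> \<le> c * L1_norm M u" if u: "integrable M u" for u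
  proof -
    have "F u \<le> F (\<lambda>x. \<bar>u x\<bar>)" by (intro positive_functional_mono) (use u in auto)
    moreover have "F (\<lambda>x. (-1) * u x) \<le> F (\<lambda>x. \<bar>u x\<bar>)" by (intro positive_functional_mono) (use u in auto)
    moreover have "F (\<lambda>x. (-1) * u x) = - F u" using positive_functional_scale[OF u, of "-1"] by simp
    moreover have "F (\<lambda>x. \<bar>u x\<bar>) \<le> c * L1_norm M u"
      unfolding L1_norm_def by (rule c) (use u in auto)
    ultimately show ?thesis by simp
  qed
  then show ?thesis using c(1) by blast
qed

text \<open>
  The form of continuity that matches the approximation by simple functions in the induction
  principle for integrable functions.
\<close>

lemma positive_functional_tendsto:
  assumes s: "\<And>i. integrable M (s i)" and u: "integrable M u"
    and lim: "\<And>x. x \<in> space M \<Longrightarrow> (\<lambda>i. s i x) \<longlonglongrightarrow> u x"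
    and bound: "\<And>i x. x \<in> space M \<Longrightarrow> \<bar>s i x\<bar> \<le> 2 * \<bar>u x\<bar>"
  shows "(\<lambda>i. F (s i)) \<longlonglongrightarrow> F u"
proof -
  obtain c where c: "c \<ge> 0" "\<And>u. integrable M u \<Longrightarrow> \<bar>F u\<bar> \<le> c * L1_norm M u"
    using positive_functional_bounded by blast
  have "(\<lambda>i. L1_norm M (\<lambda>x. s i x - u x)) \<longlonglongrightarrow> (\<integral>x. 0 \<partial>M)"
    unfolding L1_norm_def
  proof (rule integral_dominated_convergence)
    show "integrable M (\<lambda>x. 3 * \<bar>u x\<bar>)" using u by simp
    show "AE x in M. (\<lambda>i. \<bar>s i x - u x\<bar>) \<longlonglongrightarrow> 0"
    proof (rule AE_I2)
      fix x assume "x \<in> space M"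
      then show "(\<lambda>i. \<bar>s i x - u x\<bar>) \<longlonglongrightarrow> 0"
        using lim LIM_zero tendsto_rabs_zero by blast
    qed
    show "AE x in M. norm \<bar>s i x - u x\<bar> \<le> 3 * \<bar>u x\<bar>" for i
    proof (rule AE_I2)
      fix x assume "x \<in> space M"
      then show "norm \<bar>s i x - u x\<bar> \<le> 3 * \<bar>u x\<bar>" using bound[of x i] by auto
    qed
  qed (use s u in auto)
  then have "(\<lambda>i. c * L1_norm M (\<lambda>x. s i x - u x)) \<longlonglongrightarrow> 0"
    by (auto intro: tendsto_mult_right_zero)
  then have "(\<lambda>i. F (s i) - F u) \<longlonglongrightarrow> 0"
  proof (rule Lim_null_comparison[rotated])
    show "\<forall>\<^sub>F i in sequentially. norm (F (s i) - F u) \<le> c * L1_norm M (\<lambda>x. s i x - u x)"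
      using c(2)[of "\<lambda>x. s _ x - u x"] positive_functional_diff s u by auto
  qed
  then show ?thesis by (rule LIM_zero_cancel)
qed

end

text \<open>
  The set function \<open>E \<mapsto> F (indicator E)\<close> is a finite measure because \<open>F\<close> is bounded, and it vanishes on
  null sets; the Radon-Nikodym theorem gives its density.
\<close>

lemma positive_functional_density:
  assumes M: "finite_measure M" and F: "positive_functional M F"
  shows "\<exists>q. integrable M q \<and> (\<forall>x. 0 \<le> q x) \<and>
    (\<forall>E\<in>sets M. F (indicator E) = (\<integral>x. q x * indicator E x \<partial>M))"
proof -
  interpret finite_measure M by fact
  obtain c where c: "c \<ge> 0" "\<And>u. integrable M u \<Longrightarrow> \<bar>F u\<bar> \<le> c * L1_norm M u"
    using positive_functional_bounded[OF F] by blast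
  have ind[simp]: "integrable M (indicator E :: 'a \<Rightarrow> real)" if "E \<in> sets M" for E
    using that by (simp add: less_top[symmetric])
  have nn: "0 \<le> F (indicator E)" if "E \<in> sets M" for E
    by (rule positive_functional_nonneg[OF F]) (use that in auto)
  have le: "F (indicator E) \<le> c * measure M E" if "E \<in> sets M" for E
    using c(2)[OF ind[OF that]] that by (simp add: L1_norm_def)
  have F0: "F (indicator {}) = 0" using le[of "{}"] nn[of "{}"] by simp
  define \<nu> where "\<nu> E = ennreal (F (indicator E))" for E
  define N where "N = measure_of (space M) (sets M) \<nu>"
  have pos: "positive (sets M) \<nu>" by (simp add: positive_def \<nu>_def F0)
  have ca: "countably_additive (sets M) \<nu>"
  proof (rule sets.empty_continuous_imp_countably_additive[OF pos])
    show "additive (sets M) \<nu>"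
    proof (clarsimp simp: additive_def \<nu>_def)
      fix A B assume A: "A \<in> sets M" "B \<in> sets M" "A \<inter> B = {}"
      have "(indicator (A \<union> B) :: 'a \<Rightarrow> real) = (\<lambda>x. indicator A x + indicator B x)"
        using A(3) by (auto simp: indicator_def fun_eq_iff)
      then have "F (indicator (A \<union> B)) = F (indicator A) + F (indicator B)"
        using positive_functional_add[OF F ind[OF A(1)] ind[OF A(2)]] by simp
      then show "ennreal (F (indicator (A \<union> B))) = ennreal (F (indicator A)) + ennreal (F (indicator B))"
        using nn A by simp
    qed
    fix A :: "nat \<Rightarrow> 'a set" assume A: "range A \<subseteq> sets M" "decseq A" "(\<Inter>i. A i) = {}"
    have "(\<lambda>i. measure M (A i)) \<longlonglongrightarrow> measure M (\<Inter>i. A i)"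
      by (rule finite_Lim_measure_decseq[OF A(1,2)])
    then have "(\<lambda>i. c * measure M (A i)) \<longlonglongrightarrow> 0" using A(3) by (auto intro: tendsto_mult_right_zero)
    then have lim: "(\<lambda>i. c * measure M (A i)) \<longlonglongrightarrow> 0" .
    have "(\<lambda>i. F (indicator (A i))) \<longlonglongrightarrow> 0"
    proof (rule real_tendsto_sandwich[OF _ _ tendsto_const lim])
      show "\<forall>\<^sub>F i in sequentially. 0 \<le> F (indicator (A i))"
        using A(1) by (intro always_eventually allI nn) auto
      show "\<forall>\<^sub>F i in sequentially. F (indicator (A i)) \<le> c * measure M (A i)"
        using A(1) by (intro always_eventually allI le) auto
    qed
    then show "(\<lambda>i. \<nu> (A i)) \<longlonglongrightarrow> 0"
      unfolding \<nu>_def using tendsto_ennrealI by fastforce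
  qed (simp add: \<nu>_def)
  have emN: "emeasure N E = \<nu> E" if "E \<in> sets M" for E
    by (rule emeasure_measure_of[OF N_def]) (use pos ca that sets.space_closed in \<open>auto simp: N_def\<close>)
  have setsN: "sets N = sets M" by (simp add: N_def)
  have "absolutely_continuous M N"
    unfolding absolutely_continuous_def
  proof
    fix E assume "E \<in> null_sets M"
    then have "E \<in> sets M" "measure M E = 0" by (auto simp: measure_def)
    then have "\<nu> E = 0" using le[of E] nn[of E] by (simp add: \<nu>_def)
    then show "E \<in> null_sets N" using emN setsN \<open>E \<in> sets M\<close> by auto
  qed
  then obtain h where h[measurable]: "h \<in> borel_measurable M" and hN: "density M h = N"
    using Radon_Nikodym setsN by blast
  have hE: "(\<integral>\<^sup>+x. h x * indicator E x \<partial>M) = \<nu> E" if "E \<in> sets M" for E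
    using emN[OF that] that by (simp add: hN[symmetric] emeasure_density)
  have "(\<integral>\<^sup>+x. h x \<partial>M) = (\<integral>\<^sup>+x. h x * indicator (space M) x \<partial>M)"
    by (auto intro: nn_integral_cong)
  then have hfin: "(\<integral>\<^sup>+x. h x \<partial>M) < \<infinity>" using hE[of "space M"] by (simp add: \<nu>_def)
  then have "AE x in M. h x \<noteq> \<infinity>" by (intro nn_integral_PInf_AE) auto
  then have hq: "AE x in M. ennreal (enn2real (h x)) = h x"
    by (auto simp: less_top elim: eventually_mono)
  define q where "q x = enn2real (h x)" for x
  have q: "integrable M q"
  proof (rule integrableI_nonneg)
    have "(\<integral>\<^sup>+x. ennreal (q x) \<partial>M) = (\<integral>\<^sup>+x. h x \<partial>M)"
      unfolding q_def by (rule nn_integral_cong_AE[OF hq])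
    then show "(\<integral>\<^sup>+x. ennreal (q x) \<partial>M) < \<infinity>" using hfin by simp
    show "q \<in> borel_measurable M" unfolding q_def[abs_def] by measurable
  qed (simp add: q_def)
  have "F (indicator E) = (\<integral>x. q x * indicator E x \<partial>M)" if E: "E \<in> sets M" for E
  proof -
    have "(\<integral>\<^sup>+x. ennreal (q x * indicator E x) \<partial>M) = (\<integral>\<^sup>+x. h x * indicator E x \<partial>M)"
      by (rule nn_integral_cong_AE)
        (use hq in eventually_elim, auto simp: q_def indicator_def)
    also have "\<dots> = ennreal (F (indicator E))" using hE[OF E] by (simp add: \<nu>_def)
    finally show ?thesis
      using E nn q by (subst integral_eq_nn_integral) (auto simp: q_def)
  qed
  then show ?thesis using q by (intro exI[of _ q]) (auto simp: q_def)
qed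

text \<open>
  Duality of \<open>L\<^sup>1\<close> and \<open>L\<^sup>\<infinity>\<close> for positive functionals. The density of the associated measure cannot
  exceed the norm bound of \<open>F\<close> on a set of positive measure, hence lies in \<open>L\<^sup>\<infinity>\<close>; equality on indicators
  extends to \<open>L\<^sup>1\<close> by continuity.
\<close>

lemma positive_functional_represented:
  assumes M: "finite_measure M" and F: "positive_functional M F"
  shows "\<exists>q\<in>Linf M. \<forall>v\<in>L1 M. pairing M q v = F v"
proof -
  interpret finite_measure M by fact
  obtain c where c: "c \<ge> 0" "\<And>u. integrable M u \<Longrightarrow> \<bar>F u\<bar> \<le> c * L1_norm M u"
    using positive_functional_bounded[OF F] by blast
  obtain q where q: "integrable M q" "\<And>x. 0 \<le> q x"
    "\<And>E. E \<in> sets M \<Longrightarrow> F (indicator E) = (\<integral>x. q x * indicator E x \<partial>M)"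
    using positive_functional_density[OF M F] by blast
  have [measurable]: "q \<in> borel_measurable M" using q(1) by auto
  have ae: "AE x in M. q x \<le> c"
  proof -
    define E where "E = {x \<in> space M. c < q x}"
    have E[measurable]: "E \<in> sets M" by (simp add: E_def)
    have qE: "integrable M (\<lambda>x. q x * indicator E x)"
      using integrable_real_mult_indicator[OF E q(1)] by simp
    have cE: "integrable M (\<lambda>x. c * indicator E x)"
      by (simp add: less_top[symmetric])
    have "F (indicator E) \<le> c * measure M E"
      using c(2)[of "indicator E"] by (simp add: L1_norm_def less_top[symmetric])
    then have "(\<integral>x. q x * indicator E x - c * indicator E x \<partial>M) \<le> 0"
      using q(3)[OF E] qE cE by simp
    moreover have nn: "0 \<le> q x * indicator E x - c * indicator E x" for x
      by (auto simp: E_def indicator_def)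
    ultimately have "(\<integral>x. q x * indicator E x - c * indicator E x \<partial>M) = 0"
      by (meson Bochner_Integration.integral_nonneg order_antisym)
    then have "AE x in M. q x * indicator E x - c * indicator E x = 0"
      using integral_nonneg_eq_0_iff_AE[of M "\<lambda>x. q x * indicator E x - c * indicator E x"]
        qE cE nn by auto
    then show ?thesis
      using AE_space by eventually_elim (auto simp: E_def indicator_def split: if_splits)
  qed
  have qL: "q \<in> Linf M"
    using ae q(2) by (auto simp: Linf_iff_AE_bounded intro!: exI[of _ c])
  have prod: "integrable M (\<lambda>x. q x * v x)" if "integrable M v" for v
  proof (rule Bochner_Integration.integrable_bound[of _ "\<lambda>x. c * v x"])
    show "AE x in M. norm (q x * v x) \<le> norm (c * v x)"
      using ae by eventually_elim (use q(2) c(1) in \<open>auto simp: abs_mult intro: mult_right_mono\<close>)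
  qed (use that in auto)
  have "F v = (\<integral>x. q x * v x \<partial>M)" if "integrable M v" for v
    using that
  proof induction
    case (base A t)
    then show ?case
      using positive_functional_scale[OF F, of "indicator A" t] q(3)[of A]
      by (simp add: mult.commute mult.left_commute)
  next
    case (add f g)
    then show ?case using positive_functional_add[OF F, of f g] prod[of f] prod[of g] by (simp add: distrib_left)
  next
    case (lim f s)
    have "(\<lambda>i. F (s i)) \<longlonglongrightarrow> F f"
      by (rule positive_functional_tendsto[OF F]) (use lim in auto)
    moreover have "(\<lambda>i. \<integral>x. q x * s i x \<partial>M) \<longlonglongrightarrow> (\<integral>x. q x * f x \<partial>M)"
    proof (rule integral_dominated_convergence)
      show "integrable M (\<lambda>x. 2 * \<bar>q x * f x\<bar>)" using prod[OF lim(4)] by simp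
      show "AE x in M. (\<lambda>i. q x * s i x) \<longlonglongrightarrow> q x * f x"
        using lim(2) by (intro AE_I2 tendsto_mult tendsto_const) auto
      show "AE x in M. norm (q x * s i x) \<le> 2 * \<bar>q x * f x\<bar>" for i
      proof (rule AE_I2)
        fix x assume "x \<in> space M"
        then have "\<bar>s i x\<bar> \<le> 2 * \<bar>f x\<bar>" using lim(3)[of x i] by simp
        then have "q x * \<bar>s i x\<bar> \<le> q x * (2 * \<bar>f x\<bar>)" using q(2) by (intro mult_left_mono)
        then show "norm (q x * s i x) \<le> 2 * \<bar>q x * f x\<bar>" using q(2)[of x] by (simp add: abs_mult)
      qed
    qed (use lim in auto)
    ultimately show ?case using lim(5) LIMSEQ_unique by simp
  qed
  then show ?thesis using qL by (auto simp: pairing_def L1_def)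
qed

section \<open>Adjoints of regular operators\<close>

lemma Linf_mult_L1_integrable:
  assumes "q \<in> Linf M" "v \<in> L1 M"
  shows "integrable M (\<lambda>x. q x * v x)"
proof -
  from assms(1) obtain c where c: "AE x in M. \<bar>q x\<bar> \<le> c" and q: "q \<in> borel_measurable M"
    by (auto simp: Linf_iff_AE_bounded)
  show ?thesis
  proof (rule Bochner_Integration.integrable_bound)
    show "integrable M (\<lambda>x. c * v x)" using assms(2) by (simp add: L1_def)
    show "AE x in M. norm (q x * v x) \<le> norm (c * v x)"
      using c by eventually_elim (auto simp: abs_mult intro!: mult_right_mono)
  qed (use q assms(2) in \<open>auto simp: L1_def\<close>)
qed

lemma pairing_diff_left:
  "p \<in> Linf M \<Longrightarrow> q \<in> Linf M \<Longrightarrow> v \<in> L1 M \<Longrightarrow>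
    pairing M (\<lambda>x. p x - q x) v = pairing M p v - pairing M q v"
  by (simp add: pairing_def left_diff_distrib Linf_mult_L1_integrable)

lemma pairing_diff_right:
  "p \<in> Linf M \<Longrightarrow> u \<in> L1 M \<Longrightarrow> v \<in> L1 M \<Longrightarrow>
    pairing M p (\<lambda>x. u x - v x) = pairing M p u - pairing M p v"
  by (simp add: pairing_def right_diff_distrib Linf_mult_L1_integrable)

lemma pairing_uminus_left: "pairing M (\<lambda>x. - q x) v = - pairing M q v"
  by (simp add: pairing_def)

lemma pairing_nonneg:
  assumes "nonneg M p" "nonneg M v"
  shows "0 \<le> pairing M p v"
  unfolding pairing_def
proof (rule integral_nonneg_AE)
  show "AE x in M. 0 \<le> p x * v x"
    using assms unfolding nonneg_def ae_le_def by eventually_elim simp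
qed

lemma ae_eq_imp_ae_le:
  assumes "ae_eq M f g"
  shows "ae_le M f g" "ae_le M g f"
  using assms unfolding ae_eq_def ae_le_def by (eventually_elim, simp)+

lemma Linf_dual_lin:
  "\<mu> \<in> Linf_dual M \<Longrightarrow> \<phi> \<in> Linf M \<Longrightarrow> \<psi> \<in> Linf M \<Longrightarrow>
    \<mu> (\<lambda>x. a * \<phi> x + b * \<psi> x) = a * \<mu> \<phi> + b * \<mu> \<psi>"
  by (simp add: Linf_dual_def)

lemma Linf_dual_scale: "\<mu> \<in> Linf_dual M \<Longrightarrow> \<phi> \<in> Linf M \<Longrightarrow> \<mu> (\<lambda>x. a * \<phi> x) = a * \<mu> \<phi>"
  using Linf_dual_lin[of \<mu> M \<phi> \<phi> a 0] by simp

lemma Linf_dual_uminus: "\<mu> \<in> Linf_dual M \<Longrightarrow> \<phi> \<in> Linf M \<Longrightarrow> \<mu> (\<lambda>x. - \<phi> x) = - \<mu> \<phi>"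
  using Linf_dual_scale[of \<mu> M \<phi> "-1"] by simp

lemma Linf_dual_diff:
  "\<mu> \<in> Linf_dual M \<Longrightarrow> \<phi> \<in> Linf M \<Longrightarrow> \<psi> \<in> Linf M \<Longrightarrow> \<mu> (\<lambda>x. \<phi> x - \<psi> x) = \<mu> \<phi> - \<mu> \<psi>"
  using Linf_dual_lin[of \<mu> M \<phi> \<psi> 1 "-1"] by simp

lemma Linf_dual_scaled:
  assumes F: "F \<in> Linf_dual M"
  shows "(\<lambda>\<psi>. s * F \<psi>) \<in> Linf_dual M"
proof -
  obtain K where K: "\<And>\<psi>. \<psi> \<in> Linf M \<Longrightarrow> \<bar>F \<psi>\<bar> \<le> K * Linf_norm M \<psi>"
    using F unfolding Linf_dual_def by blast
  have "\<bar>s * F \<psi>\<bar> \<le> (\<bar>s\<bar> * K) * Linf_norm M \<psi>" if "\<psi> \<in> Linf M" for \<psi>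
    using mult_left_mono[OF K[OF that], of "\<bar>s\<bar>"] by (simp add: abs_mult mult.assoc)
  then have "\<exists>K. \<forall>\<psi>\<in>Linf M. \<bar>s * F \<psi>\<bar> \<le> K * Linf_norm M \<psi>" by blast
  moreover have "s * F (\<lambda>x. a * \<phi> x + b * \<psi> x) = a * (s * F \<phi>) + b * (s * F \<psi>)"
    if "\<phi> \<in> Linf M" "\<psi> \<in> Linf M" for \<phi> \<psi> a b
    using F that by (simp add: Linf_dual_def algebra_simps)
  ultimately show ?thesis by (simp add: Linf_dual_def)
qed

lemma Linf_dual_mono:
  assumes "\<mu> \<in> Linf_dual M" "Linf_dual_nonneg M \<mu>" "\<phi> \<in> Linf M" "\<psi> \<in> Linf M" "ae_le M \<phi> \<psi>"
  shows "\<mu> \<phi> \<le> \<mu> \<psi>"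
proof -
  have "0 \<le> \<mu> (\<lambda>x. \<psi> x - \<phi> x)"
    using assms Linf_diff[of \<psi> M \<phi>] by (simp add: Linf_dual_nonneg_def nonneg_def ae_le_def)
  then show ?thesis using Linf_dual_diff[OF assms(1,4,3)] by simp
qed

lemma Linf_dual_ae_cong:
  assumes "\<mu> \<in> Linf_dual M" "Linf_dual_nonneg M \<mu>" "\<phi> \<in> Linf M" "\<psi> \<in> Linf M" "ae_eq M \<phi> \<psi>"
  shows "\<mu> \<phi> = \<mu> \<psi>"
proof (rule antisym)
  show "\<mu> \<phi> \<le> \<mu> \<psi>"
    using assms ae_eq_imp_ae_le[of M \<phi> \<psi>] by (intro Linf_dual_mono[where M = M]) auto
  show "\<mu> \<psi> \<le> \<mu> \<phi>"
    using assms ae_eq_imp_ae_le[of M \<phi> \<psi>] by (intro Linf_dual_mono[where M = M]) auto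
qed

lemma positive_functional_comp:
  assumes P: "positive_op M P" and \<mu>: "\<mu> \<in> Linf_dual M" "Linf_dual_nonneg M \<mu>"
  shows "positive_functional M (\<lambda>v. \<mu> (P v))"
  unfolding positive_functional_def
proof (intro conjI ballI allI impI)
  fix u v a b assume uv: "u \<in> L1 M" "v \<in> L1 M"
  have Pu: "P u \<in> Linf M" "P v \<in> Linf M" "P (\<lambda>x. a * u x + b * v x) \<in> Linf M"
    using P uv L1_linear_comb[of u M v a b] by (auto simp: positive_op_def linear_op_def)
  have "\<mu> (P (\<lambda>x. a * u x + b * v x)) = \<mu> (\<lambda>x. a * P u x + b * P v x)"
    using P uv Pu Linf_linear_comb[of "P u" M "P v" a b]
    by (intro Linf_dual_ae_cong[OF \<mu>]) (auto simp: positive_op_def linear_op_def)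
  then show "\<mu> (P (\<lambda>x. a * u x + b * v x)) = a * \<mu> (P u) + b * \<mu> (P v)"
    using Linf_dual_lin[OF \<mu>(1) Pu(1,2)] by simp
next
  fix u assume "u \<in> L1 M" "nonneg M u"
  then show "0 \<le> \<mu> (P u)"
    using P \<mu>(2) by (auto simp: positive_op_def linear_op_def Linf_dual_nonneg_def)
qed

text \<open>
  A regular operator composed with a positive functional on \<open>L\<^sup>\<infinity>\<close> is a difference of two positive
  functionals on \<open>L\<^sup>1\<close>, so the representation of the latter applies to each part.
\<close>

lemma regular_op_functional_represented:
  assumes M: "finite_measure M" and T: "regular_op M T"
    and \<mu>: "\<mu> \<in> Linf_dual M" "Linf_dual_nonneg M \<mu>"
  shows "\<exists>q\<in>Linf M. \<forall>v\<in>L1 M. pairing M q v = \<mu> (T v)"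
proof -
  obtain P Q where P: "positive_op M P" and Q: "positive_op M Q"
    and PQ: "\<And>u. u \<in> L1 M \<Longrightarrow> ae_eq M (T u) (\<lambda>x. P u x - Q u x)"
    using T by (auto simp: regular_op_def)
  obtain p q where p: "p \<in> Linf M" "\<And>v. v \<in> L1 M \<Longrightarrow> pairing M p v = \<mu> (P v)"
    and q: "q \<in> Linf M" "\<And>v. v \<in> L1 M \<Longrightarrow> pairing M q v = \<mu> (Q v)"
    using positive_functional_represented[OF M positive_functional_comp[OF P \<mu>]]
      positive_functional_represented[OF M positive_functional_comp[OF Q \<mu>]] by blast
  have "pairing M (\<lambda>x. p x - q x) v = \<mu> (T v)" if v: "v \<in> L1 M" for v
  proof -
    have L: "P v \<in> Linf M" "Q v \<in> Linf M" "T v \<in> Linf M"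
      using P Q T v by (auto simp: positive_op_def linear_op_def regular_op_def)
    have "\<mu> (T v) = \<mu> (\<lambda>x. P v x - Q v x)"
      using L PQ[OF v] by (intro Linf_dual_ae_cong[OF \<mu>] Linf_diff)
    then show ?thesis
      using Linf_dual_diff[OF \<mu>(1) L(1,2)] pairing_diff_left[OF p(1) q(1) v] p(2)[OF v] q(2)[OF v]
      by simp
  qed
  then show ?thesis using Linf_diff[OF p(1) q(1)] by blast
qed

text \<open>
  The choice in \<^const>\<open>adjoint_op\<close> is meaningful for nonnegative multipliers: the functional
  \<open>v \<mapsto> (\<mu>, B v)\<close> does have a representative in \<open>L\<^sup>\<infinity>\<close>. The elements \<open>\<mu>\<close> of the dual of \<open>L\<^sup>\<infinity>\<close> themselves
  may be singular.
\<close>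

lemma adjoint_constraint_op:
  assumes M: "finite_measure M" and S: "regular_op M S" and T: "regular_op M T"
    and \<mu>: "\<mu> \<in> dual_pairs M" "dpair_nonneg M \<mu>"
  shows "adjoint_op M (constraint_op S T) \<mu> \<in> Linf M"
    and "v \<in> L1 M \<Longrightarrow>
      pairing M (adjoint_op M (constraint_op S T) \<mu>) v = dpairing \<mu> (constraint_op S T v)"
proof -
  let ?P = "\<lambda>q. q \<in> Linf M \<and> (\<forall>v\<in>L1 M. pairing M q v = dpairing \<mu> (constraint_op S T v))"
  have \<mu>': "fst \<mu> \<in> Linf_dual M" "Linf_dual_nonneg M (fst \<mu>)"
    "snd \<mu> \<in> Linf_dual M" "Linf_dual_nonneg M (snd \<mu>)"
    using \<mu> by (auto simp: dual_pairs_def dpair_nonneg_def)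
  obtain p q where p: "p \<in> Linf M" "\<And>v. v \<in> L1 M \<Longrightarrow> pairing M p v = fst \<mu> (S v)"
    and q: "q \<in> Linf M" "\<And>v. v \<in> L1 M \<Longrightarrow> pairing M q v = snd \<mu> (T v)"
    using regular_op_functional_represented[OF M S \<mu>'(1,2)]
      regular_op_functional_represented[OF M T \<mu>'(3,4)] by blast
  have "pairing M (\<lambda>x. p x - q x) v = dpairing \<mu> (constraint_op S T v)" if v: "v \<in> L1 M" for v
  proof -
    have "T v \<in> Linf M" using T v by (auto simp: regular_op_def linear_op_def)
    then show ?thesis
      using Linf_dual_uminus[OF \<mu>'(3)] p q v
      by (simp add: dpairing_def constraint_op_def pairing_diff_left)
  qed
  then have "?P (\<lambda>x. p x - q x)" using Linf_diff[OF p(1) q(1)] by blast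
  then have *: "?P (adjoint_op M (constraint_op S T) \<mu>)"
    unfolding adjoint_op_def by (rule someI[of ?P])
  then show "adjoint_op M (constraint_op S T) \<mu> \<in> Linf M" by simp
  show "pairing M (adjoint_op M (constraint_op S T) \<mu>) v = dpairing \<mu> (constraint_op S T v)"
    if "v \<in> L1 M" using * that by simp
qed

lemma linear_op_combine:
  assumes S: "linear_op M S" and T: "linear_op M T"
  shows "linear_op M (\<lambda>u x. a * S u x + b * T u x)"
  unfolding linear_op_def
proof (intro conjI ballI allI impI)
  fix u assume "u \<in> L1 M"
  then show "(\<lambda>x. a * S u x + b * T u x) \<in> Linf M"
    using S T by (intro Linf_linear_comb) (auto simp: linear_op_def)
next
  fix u v assume uv: "u \<in> L1 M" "v \<in> L1 M"
  {
    assume "ae_eq M u v"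
    then have "ae_eq M (S u) (S v)" "ae_eq M (T u) (T v)"
      using S T uv by (auto simp: linear_op_def)
    then show "ae_eq M (\<lambda>x. a * S u x + b * T u x) (\<lambda>x. a * S v x + b * T v x)"
      unfolding ae_eq_def by eventually_elim simp
  }
  fix c d
  have "ae_eq M (S (\<lambda>x. c * u x + d * v x)) (\<lambda>x. c * S u x + d * S v x)"
    "ae_eq M (T (\<lambda>x. c * u x + d * v x)) (\<lambda>x. c * T u x + d * T v x)"
    using S T uv by (auto simp: linear_op_def)
  then show "ae_eq M (\<lambda>x. a * S (\<lambda>x. c * u x + d * v x) x + b * T (\<lambda>x. c * u x + d * v x) x)
      (\<lambda>x. c * (a * S u x + b * T u x) + d * (a * S v x + b * T v x))"
    unfolding ae_eq_def by eventually_elim (simp add: algebra_simps)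
qed

text \<open>
  If \<open>S = P - Q\<close>, then \<open>T = (P + (T - S)) - Q\<close>. This makes the exact operator regular, since it lies above
  its regular lower bound.
\<close>

lemma regular_op_above:
  assumes S: "regular_op M S" and T: "linear_op M T" and le: "op_le M S T"
  shows "regular_op M T"
proof -
  obtain P Q where P: "positive_op M P" and Q: "positive_op M Q"
    and PQ: "\<And>u. u \<in> L1 M \<Longrightarrow> ae_eq M (S u) (\<lambda>x. P u x - Q u x)"
    and S': "linear_op M S"
    using S by (auto simp: regular_op_def)
  define D where "D = (\<lambda>u x. T u x - S u x)"
  have linD: "linear_op M D" using linear_op_combine[OF T S', of 1 "-1"] by (simp add: D_def)
  have "linear_op M (\<lambda>u x. P u x + D u x)"
    using linear_op_combine[of M P D 1 1] linD P by (simp add: positive_op_def)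
  moreover have "nonneg M (\<lambda>x. P u x + D u x)" if u: "u \<in> L1 M" "nonneg M u" for u
  proof -
    have "nonneg M (P u)" "nonneg M (D u)"
      using P le u by (auto simp: positive_op_def op_le_def D_def)
    then show ?thesis unfolding nonneg_def ae_le_def by eventually_elim simp
  qed
  ultimately have "positive_op M (\<lambda>u x. P u x + D u x)" by (simp add: positive_op_def)
  moreover have "ae_eq M (T u) (\<lambda>x. (P u x + D u x) - Q u x)" if "u \<in> L1 M" for u
    using PQ[OF that] unfolding ae_eq_def by eventually_elim (simp add: D_def)
  ultimately show ?thesis using T Q unfolding regular_op_def by blast
qed

section \<open>Pairs and their total mass\<close>

lemma dpairing_mono:
  assumes "\<mu> \<in> dual_pairs M" "dpair_nonneg M \<mu>" "\<phi> \<in> Linf M \<times> Linf M" "\<psi> \<in> Linf M \<times> Linf M"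
    "pair_le M \<phi> \<psi>"
  shows "dpairing \<mu> \<phi> \<le> dpairing \<mu> \<psi>"
  using assms unfolding dpairing_def
  by (intro add_mono Linf_dual_mono[where M = M])
    (auto simp: dual_pairs_def dpair_nonneg_def pair_le_def)

lemma dpairing_diff:
  assumes "\<mu> \<in> dual_pairs M" "\<phi> \<in> Linf M \<times> Linf M" "\<psi> \<in> Linf M \<times> Linf M"
  shows "dpairing \<mu> (pair_diff \<phi> \<psi>) = dpairing \<mu> \<phi> - dpairing \<mu> \<psi>"
  using assms by (auto simp: dpairing_def pair_diff_def dual_pairs_def Linf_dual_diff)

lemma dpairing_uminus:
  assumes "\<mu> \<in> dual_pairs M" "\<phi> \<in> Linf M \<times> Linf M"
  shows "dpairing \<mu> (pair_uminus \<phi>) = - dpairing \<mu> \<phi>"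
  using assms by (auto simp: dpairing_def pair_uminus_def dual_pairs_def Linf_dual_uminus)

text \<open>
  On nonnegative multipliers this is the dual norm. Being the value at a fixed function, it is linear
  in the multiplier and passes to weak-* limits, which the norm does not.
\<close>

definition mass :: "'a dpair \<Rightarrow> real" where
  "mass \<mu> = dpairing \<mu> (pair_const 1)"

lemma pair_const_Linf: "pair_const c \<in> Linf M \<times> Linf M"
  by (simp add: pair_const_def Linf_const)

lemma pair_diff_Linf:
  "\<phi> \<in> Linf M \<times> Linf M \<Longrightarrow> \<psi> \<in> Linf M \<times> Linf M \<Longrightarrow> pair_diff \<phi> \<psi> \<in> Linf M \<times> Linf M"
  by (auto simp: pair_diff_def intro: Linf_diff)

lemma dpairing_const:
  assumes "\<mu> \<in> dual_pairs M"
  shows "dpairing \<mu> (pair_const c) = c * mass \<mu>"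
  using assms Linf_dual_scale[of "fst \<mu>" M "\<lambda>_. 1" c] Linf_dual_scale[of "snd \<mu>" M "\<lambda>_. 1" c]
  by (auto simp: mass_def dpairing_def pair_const_def dual_pairs_def Linf_const distrib_left)

lemma mass_nonneg:
  assumes "\<mu> \<in> dual_pairs M" "dpair_nonneg M \<mu>"
  shows "0 \<le> mass \<mu>"
  using dpairing_mono[OF assms pair_const_Linf pair_const_Linf, of 0 1] dpairing_const[OF assms(1)]
  by (simp add: pair_le_def ae_le_def pair_const_def)

lemma Linf_dual_one_le_norm:
  assumes "\<mu> \<in> Linf_dual M"
  shows "\<mu> (\<lambda>_. 1) \<le> Linf_dual_norm M \<mu>"
proof -
  obtain K where K: "\<And>\<psi>. \<psi> \<in> Linf M \<Longrightarrow> \<bar>\<mu> \<psi>\<bar> \<le> K * Linf_norm M \<psi>"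
    using assms unfolding Linf_dual_def by blast
  have "\<bar>\<mu> (\<lambda>_. 1)\<bar> \<le> Linf_dual_norm M \<mu>"
    unfolding Linf_dual_norm_def
  proof (rule cSUP_upper)
    show "(\<lambda>_. 1) \<in> {\<psi> \<in> Linf M. Linf_norm M \<psi> \<le> 1}"
      by (auto simp: Linf_const intro: Linf_norm_le)
    have "\<bar>\<mu> \<psi>\<bar> \<le> \<bar>K\<bar>" if \<psi>: "\<psi> \<in> Linf M" "Linf_norm M \<psi> \<le> 1" for \<psi>
    proof -
      have "K * Linf_norm M \<psi> \<le> \<bar>K\<bar> * 1"
        using \<psi> Linf_norm_nonneg[OF \<psi>(1)] by (intro mult_mono) auto
      then show ?thesis using K[OF \<psi>(1)] by simp
    qed
    then show "bdd_above ((\<lambda>\<psi>. \<bar>\<mu> \<psi>\<bar>) ` {\<psi> \<in> Linf M. Linf_norm M \<psi> \<le> 1})"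
      by (auto simp: bdd_above_def)
  qed
  then show ?thesis by simp
qed

lemma mass_le_dpair_norm: "\<mu> \<in> dual_pairs M \<Longrightarrow> mass \<mu> \<le> dpair_norm M \<mu>"
  unfolding mass_def dpairing_def pair_const_def dpair_norm_def dual_pairs_def
  by (auto intro!: add_mono Linf_dual_one_le_norm)

section \<open>Coercivity and operator bounds\<close>

lemma regulariser_zero: "regulariser M J \<Longrightarrow> J (\<lambda>_. 0) = 0"
proof -
  assume J: "regulariser M J"
  then obtain u where u: "u \<in> L1 M" by (auto simp: regulariser_def)
  have "\<forall>u\<in>L1 M. \<forall>t. J (\<lambda>x. t * u x) = ereal \<bar>t\<bar> * J u"
    using J by (simp add: regulariser_def)
  then have "J (\<lambda>x. 0 * u x) = ereal \<bar>0\<bar> * J u" using u by blast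
  then show ?thesis by simp
qed

text \<open>
  Multiples \<open>c sgn v\<close> with small \<open>c\<close> are subgradients at zero, and testing them with \<open>v\<close> gives the
  \<open>L\<^sup>1\<close> norm.
\<close>

lemma regulariser_coercive:
  assumes J: "regulariser M J" and int: "nonempty_interior M J"
  shows "\<exists>\<delta>>0. \<forall>v\<in>L1 M. ereal (\<delta> * L1_norm M v) \<le> J v"
proof -
  obtain \<delta> where \<delta>: "\<delta> > 0"
    "\<And>p. p \<in> Linf M \<Longrightarrow> Linf_norm M p < \<delta> \<Longrightarrow> p \<in> subdifferential M J (\<lambda>_. 0)"
    using int by (auto simp: nonempty_interior_def)
  have "ereal (\<delta> / 2 * L1_norm M v) \<le> J v" if v: "v \<in> L1 M" for v
  proof -
    define p where "p x = \<delta> / 2 * sgn (v x)" for x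
    have p: "p \<in> borel_measurable M" using v by (auto simp: p_def[abs_def] L1_def)
    have b: "\<bar>p x\<bar> \<le> \<delta> / 2" for x using \<delta>(1) by (auto simp: p_def abs_mult sgn_if)
    have "p \<in> Linf M" using p AE_I2[of M "\<lambda>x. \<bar>p x\<bar> \<le> \<delta> / 2"] b unfolding Linf_iff_AE_bounded by blast
    moreover have "Linf_norm M p < \<delta>"
      using Linf_norm_le[OF p, of "\<delta> / 2"] b \<delta>(1) by simp
    ultimately have "p \<in> subdifferential M J (\<lambda>_. 0)" using \<delta>(2) by simp
    then have "ereal (pairing M p v) \<le> J v" using v by (simp add: subdifferential_def)
    moreover have "pairing M p v = \<delta> / 2 * L1_norm M v"
    proof -
      have "(\<lambda>x. p x * v x) = (\<lambda>x. \<delta> / 2 * \<bar>v x\<bar>)" by (auto simp: p_def sgn_if)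
      then show ?thesis unfolding pairing_def L1_norm_def by (simp only: integral_mult_right_zero)
    qed
    ultimately show ?thesis by simp
  qed
  then show ?thesis using \<delta>(1) by (intro exI[of _ "\<delta> / 2"]) auto
qed

text \<open>
  The operator norm is a supremum over the unit ball; homogeneity carries the bound to all of \<open>L\<^sup>1\<close>,
  functions of norm zero being treated separately because they cannot be normalised.
\<close>

lemma AE_abs_le_op_bound:
  assumes T: "linear_op M T" and v: "v \<in> L1 M"
    and b: "\<And>u. u \<in> L1 M \<Longrightarrow> L1_norm M u \<le> 1 \<Longrightarrow> Linf_norm M (T u) \<le> e"
  shows "AE x in M. \<bar>T v x\<bar> \<le> e * L1_norm M v"
proof -
  have hom: "ae_eq M (T (\<lambda>x. a * v x)) (\<lambda>x. a * T v x)" for a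
  proof -
    have "ae_eq M (T (\<lambda>x. a * v x + 0 * v x)) (\<lambda>x. a * T v x + 0 * T v x)"
      using T v unfolding linear_op_def by blast
    then show ?thesis by simp
  qed
  show ?thesis
  proof (cases "L1_norm M v = 0")
    case True
    then have "AE x in M. \<bar>v x\<bar> = 0"
      using integral_nonneg_eq_0_iff_AE[of M "\<lambda>x. \<bar>v x\<bar>"] v by (auto simp: L1_def L1_norm_def)
    then have "ae_eq M v (\<lambda>x. 0 * v x)" by (simp add: ae_eq_def)
    moreover have "(\<lambda>x. 0 * v x) \<in> L1 M" by (simp add: L1_def)
    ultimately have "ae_eq M (T v) (T (\<lambda>x. 0 * v x))" using T v unfolding linear_op_def by blast
    then show ?thesis
      using hom[of 0] unfolding ae_eq_def by eventually_elim (simp add: True)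
  next
    case False
    then have pos: "0 < L1_norm M v" using L1_norm_nonneg[of M v] by simp
    define w where "w x = inverse (L1_norm M v) * v x" for x
    have w: "w \<in> L1 M" using v by (simp add: w_def[abs_def] L1_def)
    have "L1_norm M w = inverse (L1_norm M v) * L1_norm M v"
      using pos by (simp add: w_def L1_norm_def[of _ w] abs_mult) (simp add: L1_norm_def)
    then have "Linf_norm M (T w) \<le> e" using b[OF w] pos by simp
    moreover have "T w \<in> Linf M" using T w by (simp add: linear_op_def)
    ultimately have "AE x in M. \<bar>T w x\<bar> \<le> e"
      using AE_abs_le_Linf_norm[of "T w" M] by (meson eventually_mono order_trans)
    moreover have "AE x in M. T w x = inverse (L1_norm M v) * T v x"
      using hom[of "inverse (L1_norm M v)"] unfolding ae_eq_def w_def[abs_def] .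
    ultimately show ?thesis
    proof eventually_elim
      case (elim x)
      then have "inverse (L1_norm M v) * \<bar>T v x\<bar> \<le> e" using pos by (simp add: abs_mult)
      then show ?case using pos by (simp add: field_simps)
    qed
  qed
qed

section \<open>Estimates for a single perturbed problem\<close>

lemma dual_solution_maximal:
  assumes "dual_solution M J B \<phi> lam \<mu>" "lam' \<in> Linf M" "nonneg M lam'"
    "\<nu> \<in> dual_pairs M" "dpair_nonneg M \<nu>"
    "(\<lambda>x. lam' x - adjoint_op M B \<nu> x) \<in> subdifferential M J (\<lambda>_. 0)"
  shows "dpairing \<nu> (pair_uminus \<phi>) \<le> dpairing \<mu> (pair_uminus \<phi>)"
  using assms unfolding dual_solution_def is_arg_max_def by (cases \<nu>) (auto simp: not_less)

text \<open>
  A single problem with inexact data. The operator error is measured in units of the data error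
  \<open>\<epsilon>\<close>, through the ratio bound \<open>D\<close>, and \<open>\<delta>\<close> is the coercivity constant that comes from the interior point
  assumption.
\<close>

locale perturbed_problem =
  fixes M :: "'a measure"
    and J :: "('a \<Rightarrow> real) \<Rightarrow> ereal"
    and A :: "('a \<Rightarrow> real) \<Rightarrow> 'a \<Rightarrow> real" and f :: "'a \<Rightarrow> real"
    and Al Au :: "('a \<Rightarrow> real) \<Rightarrow> 'a \<Rightarrow> real" and fl fu :: "'a \<Rightarrow> real"
    and \<epsilon> C D \<delta> :: real
  assumes M: "finite_measure M"
    and J: "regulariser M J"
    and \<delta>: "0 < \<delta>"
    and coercive: "\<And>v. v \<in> L1 M \<Longrightarrow> ereal (\<delta> * L1_norm M v) \<le> J v"
    and regular: "regular_op M A" "regular_op M Al" "regular_op M Au"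
    and op_bounds: "op_le M Al A" "op_le M A Au"
    and rhs: "f \<in> Linf M" "fl \<in> Linf M" "fu \<in> Linf M"
    and \<epsilon>: "0 \<le> \<epsilon>" and C: "0 \<le> C" and D: "0 \<le> D"
    and rhs_lower: "pair_le M (pair_const \<epsilon>) (pair_diff (constraint_rhs fl fu) (constraint_rhs f f))"
    and rhs_upper: "pair_le M (pair_diff (constraint_rhs fl fu) (constraint_rhs f f)) (pair_const (C * \<epsilon>))"
    and op_error: "\<And>v. v \<in> L1 M \<Longrightarrow>
      pair_le M (pair_diff (constraint_op A A v) (constraint_op Al Au v)) (pair_const (D * \<epsilon> * L1_norm M v))"
begin

abbreviation "B \<equiv> constraint_op Al Au"
abbreviation "Bbar \<equiv> constraint_op A A"
abbreviation "\<phi> \<equiv> constraint_rhs fl fu"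
abbreviation "\<phi>bar \<equiv> constraint_rhs f f"

lemma B_Linf: "v \<in> L1 M \<Longrightarrow> B v \<in> Linf M \<times> Linf M"
  using regular by (auto simp: constraint_op_def regular_op_def linear_op_def intro: Linf_uminus)

lemma Bbar_Linf: "v \<in> L1 M \<Longrightarrow> Bbar v \<in> Linf M \<times> Linf M"
  using regular by (auto simp: constraint_op_def regular_op_def linear_op_def intro: Linf_uminus)

lemma \<phi>_Linf: "\<phi> \<in> Linf M \<times> Linf M"
  using rhs by (auto simp: constraint_rhs_def intro: Linf_uminus)

lemma \<phi>bar_Linf: "\<phi>bar \<in> Linf M \<times> Linf M"
  using rhs by (auto simp: constraint_rhs_def intro: Linf_uminus)

lemma B_le_Bbar:
  assumes "v \<in> L1 M" "nonneg M v"
  shows "pair_le M (B v) (Bbar v)"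
proof -
  have "nonneg M (\<lambda>x. A v x - Al v x)" "nonneg M (\<lambda>x. Au v x - A v x)"
    using op_bounds assms by (auto simp: op_le_def)
  then show ?thesis
    by (simp add: pair_le_def constraint_op_def nonneg_def ae_le_def)
qed

lemma dpairing_\<phi>_bounds:
  assumes "\<mu> \<in> dual_pairs M" "dpair_nonneg M \<mu>"
  shows "dpairing \<mu> \<phi>bar + \<epsilon> * mass \<mu> \<le> dpairing \<mu> \<phi>"
    and "dpairing \<mu> \<phi> \<le> dpairing \<mu> \<phi>bar + C * \<epsilon> * mass \<mu>"
  using dpairing_mono[OF assms pair_const_Linf pair_diff_Linf[OF \<phi>_Linf \<phi>bar_Linf] rhs_lower]
    dpairing_mono[OF assms pair_diff_Linf[OF \<phi>_Linf \<phi>bar_Linf] pair_const_Linf rhs_upper]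
    dpairing_const[OF assms(1)] dpairing_diff[OF assms(1) \<phi>_Linf \<phi>bar_Linf]
  by simp_all

lemma dpairing_B_error:
  assumes "\<mu> \<in> dual_pairs M" "dpair_nonneg M \<mu>" "v \<in> L1 M"
  shows "dpairing \<mu> (Bbar v) \<le> dpairing \<mu> (B v) + D * \<epsilon> * L1_norm M v * mass \<mu>"
proof -
  note L = Bbar_Linf[OF assms(3)] B_Linf[OF assms(3)]
  show ?thesis
    using dpairing_mono[OF assms(1,2) pair_diff_Linf[OF L] pair_const_Linf op_error[OF assms(3)]]
      dpairing_const[OF assms(1)] dpairing_diff[OF assms(1) L]
    by simp
qed

lemma Bbar_solution:
  assumes "ae_eq M (A w) f"
  shows "pair_le M (Bbar w) \<phi>bar" "pair_le M \<phi>bar (Bbar w)"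
  using ae_eq_imp_ae_le[OF assms]
  by (simp_all add: pair_le_def constraint_op_def constraint_rhs_def ae_le_def)

lemma exact_solution_feasible:
  assumes "w \<in> L1 M" "nonneg M w" "ae_eq M (A w) f"
  shows "pair_le M (B w) \<phi>"
proof -
  have "AE x in M. fst (B w) x \<le> fst (Bbar w) x" "AE x in M. snd (B w) x \<le> snd (Bbar w) x"
    using B_le_Bbar[OF assms(1,2)] by (auto simp: pair_le_def ae_le_def)
  moreover have "AE x in M. fst (Bbar w) x \<le> fst \<phi>bar x" "AE x in M. snd (Bbar w) x \<le> snd \<phi>bar x"
    using Bbar_solution(1)[OF assms(3)] by (auto simp: pair_le_def ae_le_def)
  moreover have "AE x in M. \<epsilon> \<le> fst \<phi> x - fst \<phi>bar x" "AE x in M. \<epsilon> \<le> snd \<phi> x - snd \<phi>bar x"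
    using rhs_lower by (auto simp: pair_le_def ae_le_def pair_const_def pair_diff_def)
  ultimately have "AE x in M. fst (B w) x \<le> fst \<phi> x" "AE x in M. snd (B w) x \<le> snd \<phi> x"
    by (eventually_elim, use \<epsilon> in linarith)+
  then show ?thesis by (simp add: pair_le_def ae_le_def)
qed

lemma source_value:
  assumes "J_minimising_solution M J A f u0" "source_condition M J Bbar u0 \<mu>"
  shows "J u0 = ereal (- dpairing \<mu> \<phi>bar)"
    and "v \<in> L1 M \<Longrightarrow> ereal (- dpairing \<mu> (Bbar v)) \<le> J v"
proof -
  have \<mu>: "\<mu> \<in> dual_pairs M" "dpair_nonneg M \<mu>"
    and sub: "(\<lambda>x. - adjoint_op M Bbar \<mu> x) \<in> subdifferential M J u0"
    using assms(2) by (auto simp: source_condition_def)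
  have u0: "u0 \<in> L1 M" "ae_eq M (A u0) f"
    using assms(1) by (auto simp: J_minimising_solution_def is_arg_min_def)
  note adj = adjoint_constraint_op[OF M regular(1) regular(1) \<mu>]
  have "dpairing \<mu> (Bbar u0) = dpairing \<mu> \<phi>bar"
    using Bbar_solution[OF u0(2)] Bbar_Linf[OF u0(1)] \<phi>bar_Linf
    by (intro antisym dpairing_mono[OF \<mu>]) auto
  then show "J u0 = ereal (- dpairing \<mu> \<phi>bar)"
    using sub adj(2)[OF u0(1)] by (simp add: subdifferential_def pairing_uminus_left)
  show "ereal (- dpairing \<mu> (Bbar v)) \<le> J v" if "v \<in> L1 M"
    using sub adj(2)[OF that] that by (auto simp: subdifferential_def pairing_uminus_left)
qed

text \<open>
  Replacing the exact operator by its lower bound in the source condition costs at most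
  \<open>D \<epsilon> mass \<mu> \<parallel>v\<parallel>\<^sub>1\<close>, and coercivity turns this into a small multiple of \<open>J v\<close>. Dividing by one plus that
  multiple restores the subgradient inequality. A relative scaling is used since it is valid for every
  size of \<open>\<mu>\<close>, not only for small \<open>\<epsilon>\<close>.
\<close>

lemma scaled_source_bound:
  assumes \<mu>: "\<mu> \<in> dual_pairs M" "dpair_nonneg M \<mu>"
    and source: "\<And>v. v \<in> L1 M \<Longrightarrow> ereal (- dpairing \<mu> (Bbar v)) \<le> J v"
    and v: "v \<in> L1 M"
  shows "ereal (- dpairing \<mu> (B v) / (1 + D * \<epsilon> * mass \<mu> / \<delta>)) \<le> J v"
proof (cases "J v")
  case (real j)
  define e where "e = D * \<epsilon> * mass \<mu>"
  have e: "0 \<le> e" using D \<epsilon> mass_nonneg[OF \<mu>] by (simp add: e_def)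
  have "\<delta> * L1_norm M v \<le> j" using coercive[OF v] real by simp
  then have "e * L1_norm M v \<le> e * (j / \<delta>)" using \<delta> e by (intro mult_left_mono) (auto simp: field_simps)
  moreover have "- dpairing \<mu> (Bbar v) \<le> j" using source[OF v] real by simp
  ultimately have "- dpairing \<mu> (B v) \<le> j + e * (j / \<delta>)"
    using dpairing_B_error[OF \<mu> v] by (simp add: e_def mult.commute mult.left_commute)
  also have "\<dots> = j * (1 + e / \<delta>)" by (simp add: algebra_simps)
  finally show ?thesis
    unfolding e_def[symmetric] real ereal_less_eq
    using e \<delta> by (subst pos_divide_le_eq) (auto intro: add_pos_nonneg)
next
  case PInf then show ?thesis by simp
next
  case MInf then show ?thesis using coercive[OF v] by simp
qed

lemma minimal_value_nonneg:
  assumes "J_minimising_solution M J A f u0" "J u0 = ereal Jstar"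
  shows "0 \<le> Jstar"
proof -
  have "0 \<le> J u0"
    using assms(1) J by (auto simp: J_minimising_solution_def is_arg_min_def regulariser_def)
  then show ?thesis using assms(2) by simp
qed

text \<open>
  The scaled source element, together with the multiplier \<open>0\<close> for the sign constraint, is feasible in
  the perturbed dual problem, and its dual value falls below the minimal value of \<open>J\<close> by at
  most a multiple of \<open>\<epsilon>\<close>. This quantitative bound on the duality gap takes the place of strong duality.
\<close>

lemma dual_value_lower_bound:
  assumes u0: "J_minimising_solution M J A f u0" and source: "source_condition M J Bbar u0 \<mu>bar"
    and Jstar: "J u0 = ereal Jstar"
    and dual: "dual_solution M J B \<phi> lam \<mu>"
  shows "Jstar - (C + D * Jstar / \<delta>) * \<epsilon> * mass \<mu>bar \<le> dpairing \<mu> (pair_uminus \<phi>)"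
proof -
  have \<mu>bar: "\<mu>bar \<in> dual_pairs M" "dpair_nonneg M \<mu>bar"
    using source by (auto simp: source_condition_def)
  \<comment> \<open>The scaling factor \<open>s\<close> differs from \<open>1\<close> by at most \<open>t\<close>, which is of order \<open>\<epsilon>\<close>.\<close>
  define t where "t = D * \<epsilon> * mass \<mu>bar / \<delta>"
  have t: "0 \<le> t" using D \<epsilon> \<delta> mass_nonneg[OF \<mu>bar] by (simp add: t_def)
  define s where "s = 1 / (1 + t)"
  have s: "0 < s" "s \<le> 1" "1 - s \<le> t"
    using t by (auto simp: s_def field_simps)
  define \<nu> where "\<nu> = ((\<lambda>\<psi>. s * fst \<mu>bar \<psi>), (\<lambda>\<psi>. s * snd \<mu>bar \<psi>))"
  have \<nu>_pair: "dpairing \<nu> \<psi> = s * dpairing \<mu>bar \<psi>" for \<psi>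
    by (simp add: \<nu>_def dpairing_def distrib_left)
  have \<nu>: "\<nu> \<in> dual_pairs M" "dpair_nonneg M \<nu>"
    using \<mu>bar s(1)
    by (auto simp: \<nu>_def dual_pairs_def dpair_nonneg_def Linf_dual_nonneg_def intro: Linf_dual_scaled)
  note adj = adjoint_constraint_op[OF M regular(2,3) \<nu>]
  have "ereal (pairing M (\<lambda>x. 0 - adjoint_op M B \<nu> x) v) \<le> J v" if v: "v \<in> L1 M" for v
    using scaled_source_bound[OF \<mu>bar source_value(2)[OF u0 source] v] adj(2)[OF v]
    by (simp add: pairing_uminus_left \<nu>_pair s_def t_def)
  then have sub: "(\<lambda>x. 0 - adjoint_op M B \<nu> x) \<in> subdifferential M J (\<lambda>_. 0)"
    using adj(1) regulariser_zero[OF J] by (auto simp: subdifferential_def pairing_def intro: Linf_uminus)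
  have "dpairing \<nu> (pair_uminus \<phi>) \<le> dpairing \<mu> (pair_uminus \<phi>)"
  proof -
    have "(\<lambda>_. 0) \<in> Linf M" "nonneg M (\<lambda>_. 0)"
      by (auto simp: Linf_const nonneg_def ae_le_def)
    then show ?thesis
      using sub \<nu> by (intro dual_solution_maximal[OF dual])
  qed
  moreover have "Jstar - (C + D * Jstar / \<delta>) * \<epsilon> * mass \<mu>bar \<le> dpairing \<nu> (pair_uminus \<phi>)"
  proof -
    have J0: "Jstar = - dpairing \<mu>bar \<phi>bar" using source_value(1)[OF u0 source] Jstar by simp
    have "0 \<le> Jstar" by (rule minimal_value_nonneg[OF u0 Jstar])
    have "0 \<le> C * \<epsilon> * mass \<mu>bar"
      using C \<epsilon> mass_nonneg[OF \<mu>bar] by simp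
    then have "s * (C * \<epsilon> * mass \<mu>bar) \<le> C * \<epsilon> * mass \<mu>bar"
      using s by (simp add: mult_left_le_one_le)
    moreover have "(1 - s) * Jstar \<le> t * Jstar" using s(3) \<open>0 \<le> Jstar\<close> by (rule mult_right_mono)
    moreover have "s * (Jstar - C * \<epsilon> * mass \<mu>bar) \<le> s * (- dpairing \<mu>bar \<phi>)"
      using dpairing_\<phi>_bounds(2)[OF \<mu>bar] J0 s(1) by (intro mult_left_mono) auto
    ultimately have "Jstar - t * Jstar - C * \<epsilon> * mass \<mu>bar \<le> s * (- dpairing \<mu>bar \<phi>)"
      by (simp add: algebra_simps)
    moreover have "(C + D * Jstar / \<delta>) * \<epsilon> * mass \<mu>bar = C * \<epsilon> * mass \<mu>bar + t * Jstar"
      using \<delta> by (simp add: t_def field_simps)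
    ultimately show ?thesis using dpairing_uminus[OF \<nu>(1) \<phi>_Linf] \<nu>_pair by simp
  qed
  ultimately show ?thesis by linarith
qed

text \<open>
  Exact solutions satisfy the constraints of the perturbed problem with slack \<open>\<epsilon>\<close>. The slack appears
  here as the additional term \<open>\<epsilon> mass \<mu>\<close>, from which the multipliers are bounded.
\<close>

lemma dual_subgradient_at_solution:
  assumes dual: "dual_solution M J B \<phi> lam \<mu>"
    and w: "w \<in> L1 M" "nonneg M w" "ae_eq M (A w) f"
  shows "dpairing \<mu> (pair_uminus \<phi>) + \<epsilon> * mass \<mu> \<le> pairing M (\<lambda>x. lam x - adjoint_op M B \<mu> x) w"
proof -
  have lam: "lam \<in> Linf M" "nonneg M lam" and \<mu>: "\<mu> \<in> dual_pairs M" "dpair_nonneg M \<mu>"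
    using dual by (auto simp: dual_solution_def is_arg_max_def)
  note adj = adjoint_constraint_op[OF M regular(2,3) \<mu>]
  have "dpairing \<mu> (B w) \<le> dpairing \<mu> (Bbar w)"
    by (rule dpairing_mono[OF \<mu> B_Linf[OF w(1)] Bbar_Linf[OF w(1)] B_le_Bbar[OF w(1,2)]])
  also have "\<dots> \<le> dpairing \<mu> \<phi>bar"
    by (rule dpairing_mono[OF \<mu> Bbar_Linf[OF w(1)] \<phi>bar_Linf Bbar_solution(1)[OF w(3)]])
  finally have "dpairing \<mu> (B w) \<le> dpairing \<mu> \<phi>bar" .
  then show ?thesis
    using pairing_nonneg[OF lam(2) w(2)] dpairing_\<phi>_bounds(1)[OF \<mu>] dpairing_uminus[OF \<mu>(1) \<phi>_Linf]
    by (simp add: pairing_diff_left[OF lam(1) adj(1) w(1)] adj(2)[OF w(1)])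
qed

text \<open>
  The subgradient is at most \<open>J\<close> at an exact solution and exceeds the dual value there by
  \<open>\<epsilon> mass \<mu>\<close>. Since the duality gap is of order \<open>\<epsilon>\<close> too, the factor \<open>\<epsilon>\<close> cancels.
\<close>

lemma dual_mass_bound:
  assumes u0: "J_minimising_solution M J A f u0" and source: "source_condition M J Bbar u0 \<mu>bar"
    and Jstar: "J u0 = ereal Jstar" and \<epsilon>_pos: "0 < \<epsilon>"
    and dual: "dual_solution M J B \<phi> lam \<mu>"
  shows "mass \<mu> \<le> (C + D * Jstar / \<delta>) * mass \<mu>bar"
proof -
  have u0': "u0 \<in> L1 M" "nonneg M u0" "ae_eq M (A u0) f"
    using u0 by (auto simp: J_minimising_solution_def is_arg_min_def)
  have "(\<lambda>x. lam x - adjoint_op M B \<mu> x) \<in> subdifferential M J (\<lambda>_. 0)"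
    using dual by (auto simp: dual_solution_def is_arg_max_def)
  then have "pairing M (\<lambda>x. lam x - adjoint_op M B \<mu> x) u0 \<le> Jstar"
    using u0'(1) Jstar by (auto simp: subdifferential_def)
  then have "\<epsilon> * mass \<mu> \<le> \<epsilon> * ((C + D * Jstar / \<delta>) * mass \<mu>bar)"
    using dual_subgradient_at_solution[OF dual u0'] dual_value_lower_bound[OF u0 source Jstar dual]
    by (simp add: mult.commute mult.left_commute)
  then show ?thesis using \<epsilon>_pos by simp
qed

lemma primal_value_le:
  assumes "primal_solution M J B \<phi> u" "w \<in> L1 M" "nonneg M w" "ae_eq M (A w) f"
  shows "J u \<le> J w"
  using assms exact_solution_feasible[OF assms(2-4)]
  unfolding primal_solution_def is_arg_min_def by (auto simp: not_less)

text \<open>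
  The half of the Bregman distance that involves the perturbed subgradient: at the minimiser it is at
  most the minimal value of \<open>J\<close>, and at an exact solution it is at least the dual value.
\<close>

lemma dual_subgradient_increment:
  assumes u0: "J_minimising_solution M J A f u0" and source: "source_condition M J Bbar u0 \<mu>bar"
    and Jstar: "J u0 = ereal Jstar"
    and dual: "dual_solution M J B \<phi> lam \<mu>"
    and u: "primal_solution M J B \<phi> u"
    and w: "w \<in> L1 M" "nonneg M w" "ae_eq M (A w) f"
  shows "pairing M (\<lambda>x. lam x - adjoint_op M B \<mu> x) (\<lambda>x. u x - w x)
    \<le> (C + D * Jstar / \<delta>) * \<epsilon> * mass \<mu>bar"
proof -
  define p where "p = (\<lambda>x. lam x - adjoint_op M B \<mu> x)"
  have p: "p \<in> subdifferential M J (\<lambda>_. 0)" and \<mu>: "\<mu> \<in> dual_pairs M" "dpair_nonneg M \<mu>"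
    using dual by (auto simp: dual_solution_def is_arg_max_def p_def)
  have u': "u \<in> L1 M" using u by (auto simp: primal_solution_def is_arg_min_def)
  have u0': "u0 \<in> L1 M" "nonneg M u0" "ae_eq M (A u0) f"
    using u0 by (auto simp: J_minimising_solution_def is_arg_min_def)
  have "ereal (pairing M p u) \<le> J u" using p u' by (simp add: subdifferential_def)
  also have "\<dots> \<le> ereal Jstar" using primal_value_le[OF u u0'] Jstar by simp
  finally have "pairing M p u \<le> Jstar" by simp
  moreover have "Jstar - (C + D * Jstar / \<delta>) * \<epsilon> * mass \<mu>bar \<le> pairing M p w"
    using dual_subgradient_at_solution[OF dual w] dual_value_lower_bound[OF u0 source Jstar dual]
      mult_nonneg_nonneg[OF \<epsilon> mass_nonneg[OF \<mu>]]
    by (simp add: p_def)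
  ultimately show ?thesis
    using p u' w(1) by (simp add: p_def[symmetric] pairing_diff_right subdifferential_def)
qed

text \<open>
  A minimiser of the perturbed problem almost satisfies the exact constraint. The operator error is
  controlled by the \<open>L\<^sup>1\<close> norm of the minimiser, which coercivity bounds.
\<close>

lemma dpairing_Bbar_primal_solution:
  assumes u: "primal_solution M J B \<phi> u" and Jstar: "J u \<le> ereal Jstar"
    and \<mu>: "\<mu> \<in> dual_pairs M" "dpair_nonneg M \<mu>"
  shows "dpairing \<mu> (Bbar u) \<le> dpairing \<mu> \<phi>bar + (C + D * Jstar / \<delta>) * \<epsilon> * mass \<mu>"
proof -
  have u': "u \<in> L1 M" "pair_le M (B u) \<phi>"
    using u by (auto simp: primal_solution_def is_arg_min_def)
  have "ereal (\<delta> * L1_norm M u) \<le> ereal Jstar" using coercive[OF u'(1)] Jstar by (rule order_trans)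
  then have "L1_norm M u \<le> Jstar / \<delta>" using \<delta> by (simp add: field_simps)
  then have "(D * \<epsilon> * mass \<mu>) * L1_norm M u \<le> (D * \<epsilon> * mass \<mu>) * (Jstar / \<delta>)"
    using D \<epsilon> mass_nonneg[OF \<mu>] by (intro mult_left_mono) auto
  moreover have "dpairing \<mu> (B u) \<le> dpairing \<mu> \<phi>"
    by (rule dpairing_mono[OF \<mu> B_Linf[OF u'(1)] \<phi>_Linf u'(2)])
  ultimately show ?thesis
    using dpairing_\<phi>_bounds(2)[OF \<mu>] dpairing_B_error[OF \<mu> u'(1)]
    by (simp add: algebra_simps)
qed

end

section \<open>Passage to the limit along the subsequence\<close>

text \<open>
  Each component is tested separately by pairing with a function in one slot and zero in the other.
\<close>

lemma weak_limit_dpair_nonneg: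
  assumes lim: "\<And>\<psi>. \<psi> \<in> Linf M \<times> Linf M \<Longrightarrow> (\<lambda>k. dpairing (\<mu> k) \<psi>) \<longlonglongrightarrow> dpairing \<mu>' \<psi>"
    and \<mu>: "\<And>k. \<mu> k \<in> dual_pairs M" "\<And>k. dpair_nonneg M (\<mu> k)" and \<mu>': "\<mu>' \<in> dual_pairs M"
  shows "dpair_nonneg M \<mu>'"
proof -
  have zero: "F (\<lambda>_. 0) = 0" if "F \<in> Linf_dual M" for F :: "('a \<Rightarrow> real) \<Rightarrow> real"
    using Linf_dual_scale[OF that Linf_const[of 1], of 0] by simp
  have nn: "0 \<le> dpairing \<mu>' \<psi>" if \<psi>: "\<psi> \<in> Linf M \<times> Linf M" "pair_le M (pair_const 0) \<psi>" for \<psi>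
  proof (rule LIMSEQ_le_const[OF lim[OF \<psi>(1)]])
    show "\<exists>N. \<forall>k\<ge>N. 0 \<le> dpairing (\<mu> k) \<psi>"
      using dpairing_mono[OF \<mu> pair_const_Linf \<psi>] dpairing_const[OF \<mu>(1), of _ 0] by simp
  qed
  have "0 \<le> fst \<mu>' \<psi>" "0 \<le> snd \<mu>' \<psi>" if "\<psi> \<in> Linf M" "nonneg M \<psi>" for \<psi>
    using nn[of "(\<psi>, \<lambda>_. 0)"] nn[of "(\<lambda>_. 0, \<psi>)"] that zero[of "fst \<mu>'"] zero[of "snd \<mu>'"] \<mu>'
      Linf_const[of 0 M]
    by (auto simp: dpairing_def pair_le_def pair_const_def nonneg_def dual_pairs_def ae_le_def)
  then show ?thesis by (simp add: dpair_nonneg_def Linf_dual_nonneg_def)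
qed

text \<open>
  The values of \<open>J\<close> cancel, which requires them to be finite.
\<close>

lemma bregman_symm_eq:
  assumes "J u = ereal a" "J v = ereal b" "u \<in> L1 M" "v \<in> L1 M"
    and q: "q \<in> domain_dual M J" and p: "p \<in> Linf M"
  shows "bregman_symm J (pairing M p) q v u =
    ereal (pairing M p (\<lambda>x. u x - v x) - q (\<lambda>x. u x - v x))"
proof -
  have "pairing M p (\<lambda>x. v x - u x) = - pairing M p (\<lambda>x. u x - v x)"
    using assms by (simp add: pairing_diff_right)
  then show ?thesis using assms(1,2) by (simp add: bregman_symm_def bregman_def)
qed

text \<open>
  The constants \<open>C\<close>, \<open>D\<close> and \<open>\<delta>\<close> are common to all members of the sequence; this uniformity is what
  makes the final constant independent of the index.
\<close>

locale perturbed_sequence =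
  fixes M :: "'a measure"
    and J :: "('a \<Rightarrow> real) \<Rightarrow> ereal"
    and A :: "('a \<Rightarrow> real) \<Rightarrow> 'a \<Rightarrow> real" and f :: "'a \<Rightarrow> real"
    and Al Au :: "nat \<Rightarrow> ('a \<Rightarrow> real) \<Rightarrow> 'a \<Rightarrow> real" and fl fu :: "nat \<Rightarrow> 'a \<Rightarrow> real"
    and \<epsilon> :: "nat \<Rightarrow> real" and C D \<delta> :: real
    and u lam :: "nat \<Rightarrow> 'a \<Rightarrow> real" and \<mu> :: "nat \<Rightarrow> 'a dpair"
    and r :: "nat \<Rightarrow> nat" and \<mu>hat :: "'a dpair" and phat :: "('a \<Rightarrow> real) \<Rightarrow> real"
  assumes problem: "\<And>n. perturbed_problem M J A f (Al n) (Au n) (fl n) (fu n) (\<epsilon> n) C D \<delta>"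
    and \<epsilon>_pos: "\<And>n. 0 < \<epsilon> n" and \<epsilon>_lim: "\<epsilon> \<longlonglongrightarrow> 0"
    and primal: "\<And>n. primal_solution M J (constraint_op (Al n) (Au n)) (constraint_rhs (fl n) (fu n)) (u n)"
    and dual: "\<And>n. dual_solution M J (constraint_op (Al n) (Au n)) (constraint_rhs (fl n) (fu n)) (lam n) (\<mu> n)"
    and limit: "limit_subgradient M J (constraint_op A A) r \<mu>
      (\<lambda>n x. lam n x - adjoint_op M (constraint_op (Al n) (Au n)) (\<mu> n) x) lam \<mu>hat phat"
begin

abbreviation "p n \<equiv> (\<lambda>x. lam n x - adjoint_op M (constraint_op (Al n) (Au n)) (\<mu> n) x)"

lemma dual_feasible:
  "lam n \<in> Linf M" "nonneg M (lam n)" "\<mu> n \<in> dual_pairs M" "dpair_nonneg M (\<mu> n)"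
  "p n \<in> subdifferential M J (\<lambda>_. 0)"
  using dual[of n] by (auto simp: dual_solution_def is_arg_max_def)

lemma limit_dpairing:
  "\<psi> \<in> Linf M \<times> Linf M \<Longrightarrow> (\<lambda>k. dpairing (\<mu> (r k)) \<psi>) \<longlonglongrightarrow> dpairing \<mu>hat \<psi>"
  using limit unfolding limit_subgradient_def by blast

lemma \<mu>hat: "\<mu>hat \<in> dual_pairs M" "dpair_nonneg M \<mu>hat"
proof -
  show "\<mu>hat \<in> dual_pairs M" using limit by (simp add: limit_subgradient_def)
  then show "dpair_nonneg M \<mu>hat"
    using weak_limit_dpair_nonneg[of M "\<lambda>k. \<mu> (r k)" \<mu>hat, OF limit_dpairing dual_feasible(3,4)]
    by blast
qed

text \<open>
  The limit of the multipliers \<open>\<lambda>\<^sub>n\<close> is nonnegative on nonnegative functions, because each of them is.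
\<close>

lemma phat_ge:
  assumes v: "v \<in> finite_domain M J" "nonneg M v"
  shows "- dpairing \<mu>hat (constraint_op A A v) \<le> phat v"
proof -
  interpret perturbed_problem M J A f "Al 0" "Au 0" "fl 0" "fu 0" "\<epsilon> 0" C D \<delta> by (rule problem)
  have "0 \<le> phat v + pairing M (adjoint_op M Bbar \<mu>hat) v"
  proof (rule LIMSEQ_le_const)
    show "(\<lambda>k. pairing M (lam (r k)) v) \<longlonglongrightarrow> phat v + pairing M (adjoint_op M Bbar \<mu>hat) v"
      using limit v(1) by (simp add: limit_subgradient_def)
    show "\<exists>N. \<forall>k\<ge>N. 0 \<le> pairing M (lam (r k)) v"
      using pairing_nonneg[OF dual_feasible(2) v(2)] by blast
  qed
  moreover have "v \<in> L1 M" using v(1) by (simp add: finite_domain_def)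
  ultimately show ?thesis using adjoint_constraint_op(2)[OF M regular(1,1) \<mu>hat] by simp
qed

lemma phat_le:
  assumes v: "v \<in> L1 M" "J v = ereal j"
  shows "phat v \<le> j"
proof (rule LIMSEQ_le_const2)
  show "(\<lambda>k. pairing M (p (r k)) v) \<longlonglongrightarrow> phat v"
    using limit v by (simp add: limit_subgradient_def finite_domain_def)
  have "ereal (pairing M (p n) v) \<le> J v" for n
    using dual_feasible(5)[of n] v(1) by (simp add: subdifferential_def)
  then show "\<exists>N. \<forall>k\<ge>N. pairing M (p (r k)) v \<le> j" using v(2) by simp
qed

context
  fixes u0 :: "'a \<Rightarrow> real" and \<mu>bar :: "'a dpair" and Jstar :: real
  assumes u0: "J_minimising_solution M J A f u0"
    and source: "source_condition M J (constraint_op A A) u0 \<mu>bar"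
    and Jstar: "J u0 = ereal Jstar"
begin

lemma mass_\<mu>hat_le: "mass \<mu>hat \<le> (C + D * Jstar / \<delta>) * mass \<mu>bar"
proof (rule LIMSEQ_le_const2)
  show "(\<lambda>k. mass (\<mu> (r k))) \<longlonglongrightarrow> mass \<mu>hat"
    unfolding mass_def by (rule limit_dpairing[OF pair_const_Linf])
  show "\<exists>N. \<forall>k\<ge>N. mass (\<mu> (r k)) \<le> (C + D * Jstar / \<delta>) * mass \<mu>bar"
    using perturbed_problem.dual_mass_bound[OF problem u0 source Jstar \<epsilon>_pos dual] by blast
qed

text \<open>
  The lower bound for the dual values survives in the limit, where the gap of order \<open>\<epsilon>\<close> disappears.
\<close>

lemma limit_dual_value_ge: "Jstar \<le> - dpairing \<mu>hat (constraint_rhs f f)"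
proof -
  interpret perturbed_problem M J A f "Al 0" "Au 0" "fl 0" "fu 0" "\<epsilon> 0" C D \<delta> by (rule problem)
  define K where "K = (C + D * Jstar / \<delta>) * mass \<mu>bar"
  have "strict_mono r" using limit by (simp add: limit_subgradient_def)
  then have \<epsilon>r: "(\<lambda>k. \<epsilon> (r k)) \<longlonglongrightarrow> 0"
    using LIMSEQ_subseq_LIMSEQ[OF \<epsilon>_lim] by (simp add: o_def)
  have "Jstar - K * 0 \<le> - dpairing \<mu>hat \<phi>bar"
  proof (rule LIMSEQ_le)
    show "(\<lambda>k. Jstar - K * \<epsilon> (r k)) \<longlonglongrightarrow> Jstar - K * 0"
      by (intro tendsto_intros \<epsilon>r)
    show "(\<lambda>k. - dpairing (\<mu> (r k)) \<phi>bar) \<longlonglongrightarrow> - dpairing \<mu>hat \<phi>bar"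
      by (intro tendsto_minus limit_dpairing \<phi>bar_Linf)
    have "Jstar - K * \<epsilon> n \<le> - dpairing (\<mu> n) \<phi>bar" for n
    proof -
      interpret n: perturbed_problem M J A f "Al n" "Au n" "fl n" "fu n" "\<epsilon> n" C D \<delta> by (rule problem)
      note \<mu>n = dual_feasible(3,4)[of n]
      have "0 \<le> \<epsilon> n * mass (\<mu> n)" using n.\<epsilon> mass_nonneg[OF \<mu>n] by simp
      then have "- dpairing (\<mu> n) n.\<phi> \<le> - dpairing (\<mu> n) \<phi>bar"
        using n.dpairing_\<phi>_bounds(1)[OF \<mu>n] by simp
      then show ?thesis
        using n.dual_value_lower_bound[OF u0 source Jstar dual] dpairing_uminus[OF \<mu>n(1) n.\<phi>_Linf]
        by (simp add: K_def mult.commute mult.left_commute)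
    qed
    then show "\<exists>N. \<forall>k\<ge>N. Jstar - K * \<epsilon> (r k) \<le> - dpairing (\<mu> (r k)) \<phi>bar" by blast
  qed
  then show ?thesis by simp
qed

text \<open>
  The limit subgradient is at most the minimal value at the exact solution, and at the perturbed
  minimiser it falls below that value by at most \<open>K \<epsilon> mass \<mu>hat\<close>. As the mass of the limit multiplier is itself
  bounded by \<open>K mass \<mu>bar\<close>, this half contributes \<open>K\<^sup>2\<close> and the perturbed subgradient contributes \<open>K\<close>.
\<close>

lemma bregman_symm_estimate:
  assumes w: "J_minimising_solution M J A f w"
  defines "K \<equiv> C + D * Jstar / \<delta>"
  shows "bregman_symm J (pairing M (p n)) phat w (u n) =
      ereal (pairing M (p n) (\<lambda>x. u n x - w x) - phat (\<lambda>x. u n x - w x))" (is ?eq)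
    and "bregman_symm J (pairing M (p n)) phat w (u n) \<le> ereal ((K + K\<^sup>2) * mass \<mu>bar * \<epsilon> n)"
proof -
  interpret perturbed_problem M J A f "Al n" "Au n" "fl n" "fu n" "\<epsilon> n" C D \<delta> by (rule problem)
  have w': "w \<in> L1 M" "nonneg M w" "ae_eq M (A w) f"
    and u0': "u0 \<in> L1 M" "nonneg M u0" "ae_eq M (A u0) f"
    using w u0 by (auto simp: J_minimising_solution_def is_arg_min_def)
  have "J w = J u0"
    using w u0 by (auto simp: J_minimising_solution_def is_arg_min_def not_less intro: antisym)
  then have Jw: "J w = ereal Jstar" using Jstar by simp
  have un: "u n \<in> L1 M" "nonneg M (u n)"
    using primal[of n] by (auto simp: primal_solution_def is_arg_min_def)
  have Jun: "J (u n) \<le> ereal Jstar" using primal_value_le[OF primal w'] Jw by simp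
  moreover have "0 \<le> J (u n)" using J un(1) by (simp add: regulariser_def)
  ultimately obtain a where a: "J (u n) = ereal a" by (cases "J (u n)") auto
  have phat: "phat \<in> domain_dual M J" using limit by (simp add: limit_subgradient_def)
  have pn: "p n \<in> Linf M" using dual_feasible(5)[of n] by (simp add: subdifferential_def)
  show eq: ?eq by (rule bregman_symm_eq[OF a Jw un(1) w'(1) phat pn])
  have fd: "u n \<in> finite_domain M J" "w \<in> finite_domain M J"
    using a Jw un w' by (auto simp: finite_domain_def)
  have "phat (\<lambda>x. 1 * u n x + (-1) * w x) = 1 * phat (u n) + (-1) * phat w"
    using phat fd unfolding domain_dual_def by blast
  then have phat_diff: "phat (\<lambda>x. u n x - w x) = phat (u n) - phat w" by simp
  have "phat w \<le> Jstar" by (rule phat_le[OF w'(1) Jw])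
  moreover have "Jstar - K * \<epsilon> n * mass \<mu>hat \<le> phat (u n)"
    using dpairing_Bbar_primal_solution[OF primal Jun \<mu>hat] limit_dual_value_ge
      phat_ge[OF fd(1) un(2)] by (simp add: K_def)
  moreover have "K * \<epsilon> n * mass \<mu>hat \<le> K\<^sup>2 * mass \<mu>bar * \<epsilon> n"
  proof -
    have "0 \<le> K * \<epsilon> n" 
      using C D \<delta> \<epsilon> minimal_value_nonneg[OF u0 Jstar] by (simp add: K_def)
    then have "(K * \<epsilon> n) * mass \<mu>hat \<le> (K * \<epsilon> n) * (K * mass \<mu>bar)"
      using mass_\<mu>hat_le by (intro mult_left_mono) (auto simp: K_def)
    then show ?thesis by (simp add: power2_eq_square mult_ac)
  qed
  moreover have "pairing M (p n) (\<lambda>x. u n x - w x) \<le> K * \<epsilon> n * mass \<mu>bar"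
    unfolding K_def by (rule dual_subgradient_increment[OF u0 source Jstar dual primal w'])
  ultimately have "pairing M (p n) (\<lambda>x. u n x - w x) - phat (\<lambda>x. u n x - w x)
      \<le> (K + K\<^sup>2) * mass \<mu>bar * \<epsilon> n"
    unfolding phat_diff by (simp add: algebra_simps)
  then show "bregman_symm J (pairing M (p n)) phat w (u n) \<le> ereal ((K + K\<^sup>2) * mass \<mu>bar * \<epsilon> n)"
    unfolding eq by simp
qed

end

end

section \<open>The convergence rate\<close>

text \<open>
  Turns the bound on the operator norm into the pointwise inequality used in the estimates; the two
  components are linear operators to which the scaling argument applies individually.
\<close>

lemma pair_op_norm_bound:
  assumes reg: "linear_op M A" "linear_op M Al" "linear_op M Au" and v: "v \<in> L1 M"
    and norm: "pair_op_norm M (\<lambda>u. pair_diff (constraint_op A A u) (constraint_op Al Au u)) \<le> ereal e"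
  shows "pair_le M (pair_diff (constraint_op A A v) (constraint_op Al Au v)) (pair_const (e * L1_norm M v))"
proof -
  let ?T = "\<lambda>u. pair_diff (constraint_op A A u) (constraint_op Al Au u)"
  have b: "Linf_norm M (fst (?T u)) \<le> e" "Linf_norm M (snd (?T u)) \<le> e"
    if "u \<in> L1 M" "L1_norm M u \<le> 1" for u
  proof -
    have "ereal (pair_norm M (?T u)) \<le> pair_op_norm M ?T"
      unfolding pair_op_norm_def using that by (intro SUP_upper) auto
    then have "ereal (pair_norm M (?T u)) \<le> ereal e" using norm by (rule order_trans)
    then show "Linf_norm M (fst (?T u)) \<le> e" "Linf_norm M (snd (?T u)) \<le> e"
      by (simp_all add: pair_norm_def)
  qed
  have lin: "linear_op M (\<lambda>u. fst (?T u))" "linear_op M (\<lambda>u. snd (?T u))"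
    using linear_op_combine[OF reg(1,2), of 1 "-1"] linear_op_combine[OF reg(1,3), of "-1" 1]
    by (simp_all add: pair_diff_def constraint_op_def)
  have "AE x in M. \<bar>fst (?T v) x\<bar> \<le> e * L1_norm M v"
    by (rule AE_abs_le_op_bound[OF lin(1) v b(1)])
  then have "AE x in M. fst (?T v) x \<le> e * L1_norm M v"
    by eventually_elim simp
  moreover have "AE x in M. \<bar>snd (?T v) x\<bar> \<le> e * L1_norm M v"
    by (rule AE_abs_le_op_bound[OF lin(2) v b(2)])
  then have "AE x in M. snd (?T v) x \<le> e * L1_norm M v"
    by eventually_elim simp
  ultimately show ?thesis by (simp add: pair_le_def ae_le_def pair_const_def)
qed

text \<open>
  The upper limit controls a tail of the sequence; the finitely many earlier ratios are absorbed by
  adding their absolute values to the bound.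
\<close>

lemma ratio_bounded:
  fixes \<eta> \<epsilon> :: "nat \<Rightarrow> real"
  assumes "limsup (\<lambda>n. ereal (\<eta> n / \<epsilon> n)) \<le> ereal D0" and pos: "\<And>n. 0 < \<epsilon> n"
  shows "\<exists>D\<ge>0. \<forall>n. \<eta> n \<le> D * \<epsilon> n"
proof -
  have "limsup (\<lambda>n. ereal (\<eta> n / \<epsilon> n)) < ereal (\<bar>D0\<bar> + 1)"
    by (rule order_le_less_trans[OF assms(1)]) simp
  then have "eventually (\<lambda>n. ereal (\<eta> n / \<epsilon> n) < ereal (\<bar>D0\<bar> + 1)) sequentially"
    by (rule Limsup_lessD)
  then obtain N where N: "\<And>n. n \<ge> N \<Longrightarrow> \<eta> n / \<epsilon> n < \<bar>D0\<bar> + 1"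
    by (auto simp: eventually_sequentially)
  define D where "D = \<bar>D0\<bar> + 1 + (\<Sum>n<N. \<bar>\<eta> n / \<epsilon> n\<bar>)"
  have sum: "0 \<le> (\<Sum>n<N. \<bar>\<eta> n / \<epsilon> n\<bar>)" by (rule sum_nonneg) simp
  have "\<eta> n / \<epsilon> n \<le> D" for n
  proof (cases "n < N")
    case True
    then have "\<bar>\<eta> n / \<epsilon> n\<bar> \<le> (\<Sum>n<N. \<bar>\<eta> n / \<epsilon> n\<bar>)" by (intro member_le_sum) auto
    then show ?thesis using abs_ge_self[of "\<eta> n / \<epsilon> n"] unfolding D_def by linarith
  next
    case False
    then show ?thesis using N[of n] sum unfolding D_def by linarith
  qed
  then have "\<eta> n \<le> D * \<epsilon> n" for n using pos[of n] by (simp add: divide_le_eq)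
  moreover have "0 \<le> D" using sum by (simp add: D_def)
  ultimately show ?thesis by blast
qed

lemma J_minimising_solution_unique_value:
  "J_minimising_solution M J A f u \<Longrightarrow> J_minimising_solution M J A f v \<Longrightarrow> J u = J v"
  by (auto simp: J_minimising_solution_def is_arg_min_def not_less intro: antisym)

theorem theorem18:
  fixes \<Omega> :: "(real ^ 'm) set"
    and M :: "(real ^ 'm) measure"
    and J :: "(real ^ 'm \<Rightarrow> real) \<Rightarrow> ereal"
    and A :: "(real ^ 'm \<Rightarrow> real) \<Rightarrow> (real ^ 'm \<Rightarrow> real)"
    and Al Au :: "nat \<Rightarrow> (real ^ 'm \<Rightarrow> real) \<Rightarrow> (real ^ 'm \<Rightarrow> real)"
    and f :: "real ^ 'm \<Rightarrow> real"
    and fl fu :: "nat \<Rightarrow> real ^ 'm \<Rightarrow> real"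
    and B :: "nat \<Rightarrow> (real ^ 'm \<Rightarrow> real) \<Rightarrow> (real ^ 'm) fpair"
    and phi :: "nat \<Rightarrow> (real ^ 'm) fpair"
    and Bbar :: "(real ^ 'm \<Rightarrow> real) \<Rightarrow> (real ^ 'm) fpair"
    and phibar :: "(real ^ 'm) fpair"
    and \<epsilon> \<eta> :: "nat \<Rightarrow> real"
    and C0 D0 :: real
    and u lam p :: "nat \<Rightarrow> real ^ 'm \<Rightarrow> real"
    and mu :: "nat \<Rightarrow> (real ^ 'm) dpair"
    and r :: "nat \<Rightarrow> nat"
    and muhat :: "(real ^ 'm) dpair"
    and phat :: "(real ^ 'm \<Rightarrow> real) \<Rightarrow> real"
  assumes domain: "open \<Omega>" "connected \<Omega>" "bounded \<Omega>" "\<Omega> \<noteq> {}"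
    and M: "M = lebesgue_on \<Omega>"
    and J: "regulariser M J"
    and f: "data_bounds M f fl fu"
    and A: "operator_bounds M A Al Au"
    and B: "B = (\<lambda>n. constraint_op (Al n) (Au n))"
    and phi: "phi = (\<lambda>n. constraint_rhs (fl n) (fu n))"
    and Bbar: "Bbar = constraint_op A A"
    and phibar: "phibar = constraint_rhs f f"
    and solvable: "\<exists>v\<in>L1 M. nonneg M v \<and> ae_eq M (A v) f \<and> J v < \<infinity>"
    and convergence: "convergence_assumption M Bbar phibar B phi \<epsilon> \<eta> C0 D0"
    and interior: "nonempty_interior M J"
    and u: "\<And>n. primal_solution M J (B n) (phi n) (u n)"
    and dual: "\<And>n. dual_solution M J (B n) (phi n) (lam n) (mu n)"
    and p: "\<And>n. p n = (\<lambda>x. lam n x - adjoint_op M (B n) (mu n) x)"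
    and phat: "limit_subgradient M J Bbar r mu p lam muhat phat"
  shows "\<exists>C. \<forall>ubar0 mubar ubar.
           J_minimising_solution M J A f ubar0 \<longrightarrow> source_condition M J Bbar ubar0 mubar \<longrightarrow>
           J_minimising_solution M J A f ubar \<longrightarrow>
           (\<forall>k. bregman_symm J (pairing M (p (r k))) phat ubar (u (r k)) =
                  ereal (pairing M (p (r k)) (\<lambda>x. u (r k) x - ubar x)
                         - phat (\<lambda>x. u (r k) x - ubar x)) \<and>
                bregman_symm J (pairing M (p (r k))) phat ubar (u (r k))
                  \<le> ereal (C * dpair_norm M mubar * \<epsilon> (r k)))"
proof -
  have "\<Omega> \<in> lmeasurable" using domain by (simp add: bounded_set_imp_lmeasurable)
  then have fin: "finite_measure M" unfolding M by (rule finite_measure_lebesgue_on)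
  obtain \<delta> where \<delta>: "\<delta> > 0" "\<And>v. v \<in> L1 M \<Longrightarrow> ereal (\<delta> * L1_norm M v) \<le> J v"
    using regulariser_coercive[OF J interior] by blast
  have \<epsilon>: "\<And>n. 0 < \<epsilon> n" "\<epsilon> \<longlonglongrightarrow> 0" and C0: "1 \<le> C0"
    and limsup: "limsup (\<lambda>n. ereal (\<eta> n / \<epsilon> n)) \<le> ereal D0"
    and conv: "\<And>n. pair_le M (pair_const (\<epsilon> n)) (pair_diff (phi n) phibar)"
      "\<And>n. pair_le M (pair_diff (phi n) phibar) (pair_const (C0 * \<epsilon> n))"
      "\<And>n. pair_op_norm M (\<lambda>u. pair_diff (Bbar u) (B n u)) \<le> ereal (\<eta> n)"
    using convergence by (auto simp: convergence_assumption_def)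
  obtain D where D: "D \<ge> 0" "\<And>n. \<eta> n \<le> D * \<epsilon> n"
    using ratio_bounded[OF limsup \<epsilon>(1)] by blast
  have ops: "linear_op M A" "\<And>n. regular_op M (Al n)" "\<And>n. regular_op M (Au n)"
    "\<And>n. op_le M (Al n) A" "\<And>n. op_le M A (Au n)"
    using A by (auto simp: operator_bounds_def)
  have problem: "perturbed_problem M J A f (Al n) (Au n) (fl n) (fu n) (\<epsilon> n) C0 D \<delta>" for n
  proof (rule perturbed_problem.intro)
    show "regular_op M A" by (rule regular_op_above[OF ops(2)[of n] ops(1) ops(4)])
    show "pair_le M (pair_diff (constraint_op A A v) (constraint_op (Al n) (Au n) v))
        (pair_const (D * \<epsilon> n * L1_norm M v))" if "v \<in> L1 M" for v
    proof (rule pair_op_norm_bound[OF ops(1) _ _ that])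
      show "pair_op_norm M (\<lambda>u. pair_diff (constraint_op A A u) (constraint_op (Al n) (Au n) u))
          \<le> ereal (D * \<epsilon> n)"
        using order_trans[OF conv(3)[of n], of "ereal (D * \<epsilon> n)"] D(2)[of n] by (simp add: B Bbar)
    qed (use ops(2,3)[of n] in \<open>simp_all add: regular_op_def\<close>)
    show "f \<in> Linf M" "fl n \<in> Linf M" "fu n \<in> Linf M" using f by (auto simp: data_bounds_def)
    show "pair_le M (pair_const (\<epsilon> n)) (pair_diff (constraint_rhs (fl n) (fu n)) (constraint_rhs f f))"
      "pair_le M (pair_diff (constraint_rhs (fl n) (fu n)) (constraint_rhs f f)) (pair_const (C0 * \<epsilon> n))"
      using conv(1,2)[of n] by (simp_all add: phi phibar)
    show "0 \<le> \<epsilon> n" "0 \<le> C0" using \<epsilon>(1)[of n] C0 by simp_all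
    show "ereal (\<delta> * L1_norm M v) \<le> J v" if "v \<in> L1 M" for v using \<delta>(2) that .
  qed (rule fin J \<delta>(1) ops D(1))+
  interpret perturbed_sequence M J A f Al Au fl fu \<epsilon> C0 D \<delta> u lam mu r muhat phat
  proof (rule perturbed_sequence.intro)
    show "perturbed_problem M J A f (Al n) (Au n) (fl n) (fu n) (\<epsilon> n) C0 D \<delta>" for n
      by (rule problem)
    show "0 < \<epsilon> n" for n by (rule \<epsilon>)
    show "\<epsilon> \<longlonglongrightarrow> 0" by (rule \<epsilon>)
    show "primal_solution M J (constraint_op (Al n) (Au n)) (constraint_rhs (fl n) (fu n)) (u n)" for n
      using u[of n] by (simp add: B phi)
    show "dual_solution M J (constraint_op (Al n) (Au n)) (constraint_rhs (fl n) (fu n)) (lam n) (mu n)" for n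
      using dual[of n] by (simp add: B phi)
    show "limit_subgradient M J (constraint_op A A) r mu
        (\<lambda>n x. lam n x - adjoint_op M (constraint_op (Al n) (Au n)) (mu n) x) lam muhat phat"
      using phat unfolding p[abs_def] B Bbar .
  qed
  \<comment> \<open>The constant may depend on the minimal value of \<open>J\<close>, which is the same for all minimising
    solutions. Fixing it by choice makes it independent of the solution and of the source element.\<close>
  define Jstar where "Jstar = real_of_ereal (J (SOME v. J_minimising_solution M J A f v))"
  define K where "K = C0 + D * Jstar / \<delta>"
  show ?thesis
  proof (intro exI[of _ "K + K\<^sup>2"] allI impI)
    fix ubar0 mubar ubar k
    assume u0: "J_minimising_solution M J A f ubar0" and src: "source_condition M J Bbar ubar0 mubar"
      and ubar: "J_minimising_solution M J A f ubar"
    interpret n: perturbed_problem M J A f "Al 0" "Au 0" "fl 0" "fu 0" "\<epsilon> 0" C0 D \<delta> by (rule problem)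
    note src' = src[unfolded Bbar]
    have "J (SOME v. J_minimising_solution M J A f v) = J ubar0"
      by (rule J_minimising_solution_unique_value[OF someI[where P = "J_minimising_solution M J A f", OF u0] u0])
    then have Jstar: "J ubar0 = ereal Jstar"
      using n.source_value(1)[OF u0 src'] by (simp add: Jstar_def)
    have "0 \<le> K"
      using C0 D(1) \<delta>(1) n.minimal_value_nonneg[OF u0 Jstar] by (simp add: K_def)
    moreover have "mass mubar \<le> dpair_norm M mubar"
      using src by (intro mass_le_dpair_norm) (simp add: source_condition_def)
    ultimately have "(K + K\<^sup>2) * mass mubar * \<epsilon> (r k) \<le> (K + K\<^sup>2) * dpair_norm M mubar * \<epsilon> (r k)"
      using less_imp_le[OF \<epsilon>(1)] by (intro mult_right_mono mult_left_mono) auto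
    then have le: "ereal ((K + K\<^sup>2) * mass mubar * \<epsilon> (r k)) \<le> ereal ((K + K\<^sup>2) * dpair_norm M mubar * \<epsilon> (r k))"
      by simp
    note estimate = bregman_symm_estimate[OF u0 src' Jstar ubar, of "r k", folded K_def]
    show "bregman_symm J (pairing M (p (r k))) phat ubar (u (r k)) =
                  ereal (pairing M (p (r k)) (\<lambda>x. u (r k) x - ubar x)
                         - phat (\<lambda>x. u (r k) x - ubar x)) \<and>
                bregman_symm J (pairing M (p (r k))) phat ubar (u (r k))
                  \<le> ereal ((K + K\<^sup>2) * dpair_norm M mubar * \<epsilon> (r k))"
      unfolding p B using estimate(1) order_trans[OF estimate(2) le] by blast
  qed
qed

end
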